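(* Let $m\ge1$ and let $f(\zeta,t)=\sum_{j=1}^{m+1}a_j(t)\zeta^j$, $0\le t<\infty$, be a global in time locally univalent polynomial solution of the Polubarinova-Galin equation, with $a_{m+1}(0)\ne0$, $q(t)>0$ and $Q(t)=\int_0^tq(s)\,ds\to\infty$ as $t\to\infty$. Let $\omega_1(t),\dots,\omega_m(t)$ be the zeros of $g(\zeta,t)=f'(\zeta,t)$, let $$\tilde\omega_k(t)=\omega_k(t)\,a_1(t)^{-\frac{m+2}{m}}\qquad(1\le k\le m)$$ be the rescaled zeros, and let $\hat\omega_1,\dots,\hat\omega_m$ be the $m$ distinct $m$-th roots of $-\dfrac{1}{(m+1)\overline{M_m}}$, where $M_m=a_1(t)^{m+1}\overline{a_{m+1}(t)}$ (a nonzero quantity independent of $t$). Then $$|\tilde\omega_k(t)-\hat\omega_k|\to0\quad\text{as }t\to\infty\qquad(1\le k\le m)$$ if the roots $\tilde\omega_k(t)$ and $\hat\omega_k$ are ordered appropriately. Furthermore, all the roots $\omega_k(t)$ eventually move away from the origin: $\frac{d}{dt}|\omega_k(t)|>0$ for all $k$ when $t$ is large enough.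
   Context: $\mathbb{D}$ is the open unit disk; dot denotes $\partial/\partial t$ and prime denotes $\partial/\partial\zeta$. Locally univalent solution: for each $t$, $f(0,t)=0$, $f'(0,t)=a_1(t)>0$, $f'(\zeta,t)\ne0$ for $\zeta\in\overline{\mathbb{D}}$, $f$ depends smoothly on $t$, and the Polubarinova-Galin equation $\operatorname{Re}[\dot f(\zeta,t)\overline{\zeta f'(\zeta,t)}]=q(t)$ holds for $\zeta\in\partial\mathbb{D}$, where $q$ is a given continuous function. The harmonic moments are $M_k(t)=\frac{1}{2\pi i}\int_{\partial\mathbb{D}}f(\zeta,t)^kf^*(\zeta,t)f'(\zeta,t)\,d\zeta$ with $f^*(\zeta,t)=\overline{f(1/\bar\zeta,t)}$; for $k\ge1$ they are independent of $t$, and in the present polynomial case $M_m=a_1^{m+1}\overline{a_{m+1}}$, so $a_{m+1}(t)\neq 0$ for all $t$. *)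

theory Defs
  imports "HOL-Complex_Analysis.Complex_Analysis"
    "HOL-Computational_Algebra.Computational_Algebra"
    "HOL-Combinatorics.Permutations"
begin

text \<open>A time-dependent map is given as \<open>f \<zeta> t\<close>, with time domain \<open>0 \<le> t < \<infinity>\<close>;
  the \<open>within\<close> makes the time derivative one-sided at \<open>t = 0\<close>.\<close>

definition time_deriv :: "(complex \<Rightarrow> real \<Rightarrow> complex) \<Rightarrow> complex \<Rightarrow> real \<Rightarrow> complex" where
  "time_deriv f \<zeta> t = vector_derivative (f \<zeta>) (at t within {0..})"

definition space_deriv :: "(complex \<Rightarrow> real \<Rightarrow> complex) \<Rightarrow> complex \<Rightarrow> real \<Rightarrow> complex" where
  "space_deriv f \<zeta> t = deriv (\<lambda>z. f z t) \<zeta>"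

text \<open>Smooth dependence on \<open>t\<close> is continuous differentiability. Infinite differentiability would
  be too much to ask when \<open>q\<close> is merely continuous: for \<open>f \<zeta> t = a t * \<zeta>\<close> the
  Polubarinova-Galin equation reads \<open>a a' = q\<close>.\<close>

definition smooth_in_time :: "(complex \<Rightarrow> real \<Rightarrow> complex) \<Rightarrow> bool" where
  "smooth_in_time f \<longleftrightarrow>
     (\<forall>\<zeta>\<in>cball 0 1. \<forall>t\<ge>0. f \<zeta> differentiable (at t within {0..})) \<and>
     continuous_on (cball 0 1 \<times> {0..}) (\<lambda>(\<zeta>, t). time_deriv f \<zeta> t)"

definition polubarinova_galin ::
    "(real \<Rightarrow> real) \<Rightarrow> (complex \<Rightarrow> real \<Rightarrow> complex) \<Rightarrow> real \<Rightarrow> bool" where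
  "polubarinova_galin q f t \<longleftrightarrow>
     (\<forall>\<zeta>\<in>sphere 0 1. Re (time_deriv f \<zeta> t * cnj (\<zeta> * space_deriv f \<zeta> t)) = q t)"

definition global_locally_univalent_solution ::
    "(real \<Rightarrow> real) \<Rightarrow> (complex \<Rightarrow> real \<Rightarrow> complex) \<Rightarrow> bool" where
  "global_locally_univalent_solution q f \<longleftrightarrow>
     (\<forall>t\<ge>0. (\<lambda>\<zeta>. f \<zeta> t) analytic_on cball 0 1 \<and>
            f 0 t = 0 \<and>
            space_deriv f 0 t \<in> \<real> \<and> 0 < Re (space_deriv f 0 t) \<and>
            (\<forall>\<zeta>\<in>cball 0 1. space_deriv f \<zeta> t \<noteq> 0)) \<and>
     smooth_in_time f \<and>
     (\<forall>t\<ge>0. polubarinova_galin q f t)"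

definition circle_reflection :: "(complex \<Rightarrow> complex) \<Rightarrow> complex \<Rightarrow> complex" where
  "circle_reflection f \<zeta> = cnj (f (1 / cnj \<zeta>))"

definition harmonic_moment :: "(complex \<Rightarrow> complex) \<Rightarrow> nat \<Rightarrow> complex" where
  "harmonic_moment f k = 1 / (2 * of_real pi * \<i>) *
     contour_integral (circlepath 0 1) (\<lambda>\<zeta>. f \<zeta> ^ k * circle_reflection f \<zeta> * deriv f \<zeta>)"

end

theory Submission
  imports Defs
begin

text \<open>
  Integrating the Polubarinova-Galin equation against \<open>f\<^sup>k\<close> over the circle shows that the
  moments \<open>M\<^sub>k\<close>, \<open>k \<ge> 1\<close>, are conserved, while \<open>M\<^sub>0 = \<Sum>j \<bar>a\<^sub>j\<bar>\<^sup>2\<close> grows like \<open>2 Q\<close>.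
  Since the zeros of \<open>f'\<close> stay outside the disc, \<open>\<bar>a\<^sub>j\<bar> \<le> 2\<^sup>m a\<^sub>1\<close>, so \<open>a\<^sub>1 \<rightarrow> \<infinity>\<close>; solving the
  conservation laws downwards from \<open>k = m\<close> yields \<open>a\<^sub>j = O(a\<^sub>1\<^sup>-\<^sup>j)\<close> for \<open>j \<ge> 2\<close>. The Fourier
  coefficients of the equation itself give \<open>\<bar>a\<^sub>j'\<bar> = O(a\<^sub>1' a\<^sub>1\<^sup>-\<^sup>j\<^sup>-\<^sup>1)\<close> and \<open>a\<^sub>1' > 0\<close> eventually.

  In the rescaled variable, \<open>f'/a\<^sub>1\<close> is \<open>1 + (m + 1) cnj M z\<^sup>m\<close> up to an error of order
  \<open>\<epsilon> = a\<^sub>1\<^sup>-\<^sup>2\<^sup>/\<^sup>m\<close>, with time derivative of order \<open>\<epsilon> a\<^sub>1'/a\<^sub>1\<close>. Hence the rescaled zeros converge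
  to the roots of the limit polynomial and move with speed \<open>O(\<epsilon> a\<^sub>1'/a\<^sub>1)\<close>, which is negligible
  against the logarithmic growth rate \<open>(1 + 2/m) a\<^sub>1'/a\<^sub>1\<close> of the scaling factor.
\<close>

section \<open>The inner product of polynomials on the unit circle\<close>

text \<open>In Parseval form, the mean of \<open>p * cnj r\<close> over the unit circle; the sum
  stops at the degree of \<open>r\<close>, beyond which all terms vanish.\<close>

definition circle_inner :: "complex poly \<Rightarrow> complex poly \<Rightarrow> complex" where
  "circle_inner p r = (\<Sum>j\<le>degree r. coeff p j * cnj (coeff r j))"

lemma circle_inner_altdef:
  assumes "degree r \<le> n"
  shows "circle_inner p r = (\<Sum>j\<le>n. coeff p j * cnj (coeff r j))"
  unfolding circle_inner_def using assms
  by (intro sum.mono_neutral_left) (auto simp: coeff_eq_0)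

lemma higher_deriv_poly: "(deriv ^^ k) (poly p) = poly ((pderiv ^^ k) (p :: complex poly))"
proof (induction k)
  case (Suc k)
  have "deriv (poly ((pderiv ^^ k) p)) = poly (pderiv ((pderiv ^^ k) p))"
    by (intro ext DERIV_imp_deriv poly_DERIV)
  with Suc show ?case by simp
qed simp

lemma has_contour_integral_poly_div_power:
  "((\<lambda>z. poly p z / z ^ Suc k) has_contour_integral 2 * of_real pi * \<i> * coeff p k) (circlepath 0 1)"
proof -
  have "((\<lambda>u. poly p u / (u - 0) ^ Suc k) has_contour_integral
          2 * of_real pi * \<i> / fact k * (deriv ^^ k) (poly p) 0) (circlepath 0 1)"
    using Cauchy_has_contour_integral_higher_derivative_circlepath[of 0 1 "poly p" 0 k]
    by (simp add: continuous_intros holomorphic_intros del: power_Suc)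
  moreover have "(deriv ^^ k) (poly p) 0 = fact k * coeff p k"
    by (simp add: higher_deriv_poly poly_0_coeff_0 coeff_higher_pderiv pochhammer_fact)
  ultimately show ?thesis by (simp add: mult.assoc del: power_Suc)
qed

lemma circle_reflection_poly:
  "circle_reflection (poly r) z = (\<Sum>j\<le>degree r. cnj (coeff r j) / z ^ j)"
  by (simp add: circle_reflection_def poly_altdef power_divide)

lemma circle_reflection_on_circle: "cmod z = 1 \<Longrightarrow> circle_reflection f z = cnj (f z)"
  using complex_div_cnj[of 1 "cnj z"] by (simp add: circle_reflection_def)

text \<open>The reflection of \<open>r\<close> is a polynomial in \<open>1 / z\<close>, so each of
  its terms makes Cauchy's formula pick out one coefficient of \<open>p\<close>. The division by
  \<open>z\<close> comes from writing the angular measure as a multiple of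
  \<open>dz / z\<close>.\<close>

lemma has_contour_integral_circle_inner:
  "((\<lambda>z. poly p z * circle_reflection (poly r) z / z) has_contour_integral
     2 * of_real pi * \<i> * circle_inner p r) (circlepath 0 1)"
proof -
  have "((\<lambda>z. \<Sum>j\<le>degree r. cnj (coeff r j) * (poly p z / z ^ Suc j)) has_contour_integral
     (\<Sum>j\<le>degree r. cnj (coeff r j) * (2 * of_real pi * \<i> * coeff p j))) (circlepath 0 1)"
    by (intro has_contour_integral_sum has_contour_integral_lmul has_contour_integral_poly_div_power) auto
  also have "(\<Sum>j\<le>degree r. cnj (coeff r j) * (2 * of_real pi * \<i> * coeff p j))
       = 2 * of_real pi * \<i> * circle_inner p r"
    by (simp add: circle_inner_def sum_distrib_left mult_ac)
  also have "(\<lambda>z. \<Sum>j\<le>degree r. cnj (coeff r j) * (poly p z / z ^ Suc j))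
       = (\<lambda>z. poly p z * circle_reflection (poly r) z / z)"
    by (simp add: fun_eq_iff circle_reflection_poly sum_distrib_left sum_divide_distrib mult_ac)
  finally show ?thesis .
qed

text \<open>Measured against \<open>dz / z\<close>, the factor \<open>f'\<close> of the moment
  becomes \<open>z * f'\<close>, which is \<open>pCons 0 (pderiv p)\<close>.\<close>

lemma harmonic_moment_poly:
  "harmonic_moment (poly p) k = circle_inner (p ^ k * pCons 0 (pderiv p)) p"
proof -
  have "((\<lambda>z. poly p z ^ k * circle_reflection (poly p) z * deriv (poly p) z) has_contour_integral
     2 * of_real pi * \<i> * circle_inner (p ^ k * pCons 0 (pderiv p)) p) (circlepath 0 1)"
    by (rule has_contour_integral_eq[OF has_contour_integral_circle_inner])
       (auto simp: DERIV_imp_deriv[OF poly_DERIV] mult_ac)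
  then show ?thesis
    by (simp add: harmonic_moment_def contour_integral_unique)
qed

text \<open>Weak form of the Polubarinova-Galin equation, with \<open>g\<close> in the role of the
  time derivative: twice the real part is multiplied by a test polynomial \<open>h\<close> and
  averaged over the circle, where \<open>h\<close> has mean \<open>coeff h 0\<close>.\<close>

lemma circle_inner_polubarinova_galin:
  assumes "\<And>z. cmod z = 1 \<Longrightarrow> Re (poly g z * cnj (z * poly (pderiv p) z)) = c"
  shows "circle_inner (h * g) (pCons 0 (pderiv p)) + circle_inner (h * pCons 0 (pderiv p)) g
           = 2 * of_real c * coeff h 0"
proof -
  let ?d = "pCons 0 (pderiv p)"
  have "((\<lambda>z. poly (h * g) z * circle_reflection (poly ?d) z / z
            + poly (h * ?d) z * circle_reflection (poly g) z / z) has_contour_integral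
       2 * of_real pi * \<i> * circle_inner (h * g) ?d + 2 * of_real pi * \<i> * circle_inner (h * ?d) g)
       (circlepath 0 1)"
    by (intro has_contour_integral_add has_contour_integral_circle_inner)
  moreover have "((\<lambda>z. poly (h * g) z * circle_reflection (poly ?d) z / z
            + poly (h * ?d) z * circle_reflection (poly g) z / z) has_contour_integral
       2 * of_real c * (2 * of_real pi * \<i> * coeff h 0)) (circlepath 0 1)"
  proof (rule has_contour_integral_eq[OF has_contour_integral_lmul[OF
            has_contour_integral_poly_div_power[of h 0]]])
    fix z assume "z \<in> path_image (circlepath 0 1)"
    then have z: "cmod z = 1" by simp
    have "poly g z * cnj (poly ?d z) + poly ?d z * cnj (poly g z) = 2 * of_real c"
      using assms[OF z] complex_add_cnj[of "poly g z * cnj (poly ?d z)"] by (simp add: mult_ac)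
    then have "2 * of_real c * poly h z
        = poly h z * (poly g z * cnj (poly ?d z) + poly ?d z * cnj (poly g z))"
      by (simp add: mult.commute)
    then show "2 * of_real c * (poly h z / z ^ Suc 0)
        = poly (h * g) z * circle_reflection (poly ?d) z / z
            + poly (h * ?d) z * circle_reflection (poly g) z / z"
      by (simp only: circle_reflection_on_circle[OF z] add_divide_distrib[symmetric] power_Suc0_right
            poly_mult times_divide_eq_right distrib_left mult.assoc)
  qed
  ultimately have "2 * of_real pi * \<i> * circle_inner (h * g) ?d
        + 2 * of_real pi * \<i> * circle_inner (h * ?d) g = 2 * of_real c * (2 * of_real pi * \<i> * coeff h 0)"
    by (rule has_contour_integral_unique)
  then have "2 * of_real pi * \<i> * (circle_inner (h * g) ?d + circle_inner (h * ?d) g)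
       = 2 * of_real pi * \<i> * (2 * of_real c * coeff h 0)"
    by (simp add: algebra_simps)
  then show ?thesis by (simp only: mult_cancel_left) simp
qed

lemma degree_pCons_0_pderiv_le: "degree (pCons 0 (pderiv p)) \<le> degree (p :: complex poly)"
  by (cases "pderiv p = 0") (auto simp: degree_pderiv pderiv_eq_0_iff)

lemma coeff_pCons_0_pderiv: "coeff (pCons 0 (pderiv p)) j = of_nat j * coeff p j"
  by (cases j) (auto simp: coeff_pderiv)

text \<open>The operator \<open>z * d/dz\<close> multiplies the \<open>j\<close>-th coefficient by
  the real number \<open>j\<close>, hence is self-adjoint. This replaces integration by parts on the
  circle.\<close>

lemma circle_inner_pderiv_commute:
  "circle_inner (pCons 0 (pderiv p)) r = circle_inner p (pCons 0 (pderiv r))"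
  by (subst circle_inner_altdef[OF degree_pCons_0_pderiv_le])
     (simp add: circle_inner_def coeff_pCons_0_pderiv mult_ac del: coeff_pCons)

section \<open>Coefficients of polynomials that vary in time\<close>

text \<open>Lagrange interpolation, with \<open>l x\<close> the basis polynomial of the node
  \<open>x\<close>. The smoothness hypothesis speaks of values at fixed points; this carries it over
  to coefficients.\<close>

lemma coeff_as_combination_of_values:
  fixes S :: "'a :: field set"
  assumes "finite S" "S \<noteq> {}"
  obtains c where "\<And>p. degree p < card S \<Longrightarrow> coeff p j = (\<Sum>x\<in>S. c x * poly p x)"
proof -
  define l where "l = (\<lambda>x. \<Prod>y\<in>S - {x}. smult (1 / (x - y)) [:-y, 1:])"
  have deg: "degree (l x) < card S" if "x \<in> S" for x
  proof -
    have "degree (l x) \<le> (\<Sum>y\<in>S - {x}. degree (smult (1 / (x - y)) [:-y, 1:]))"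
      unfolding l_def by (rule degree_prod_sum_le[of "S - {x}" "\<lambda>y. smult (1 / (x - y)) [:-y, 1:]", unfolded o_def]) (use assms in auto)
    also have "\<dots> \<le> (\<Sum>y\<in>S - {x}. 1)"
      by (intro sum_mono order.trans[OF degree_smult_le]) auto
    also have "\<dots> = card S - 1" using assms that by simp
    finally show ?thesis using that assms card_gt_0_iff[of S] by fastforce
  qed
  have val: "poly (l x) z = (if z = x then 1 else 0)" if "x \<in> S" "z \<in> S" for x z
  proof (cases "z = x")
    case True
    have "poly (smult (1 / (x - y)) [:-y, 1:]) x = 1" if "y \<in> S - {x}" for y
      using that nonzero_divide_eq_eq[of "x - y" 1 1] by (auto simp: add.commute[of _ x] simp flip: diff_divide_distrib)
    then show ?thesis using True by (simp add: l_def poly_prod)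
  next
    case False
    then show ?thesis using that assms by (auto simp: l_def poly_prod prod_zero_iff)
  qed
  show ?thesis
  proof (rule that)
    fix p :: "'a poly" assume p: "degree p < card S"
    have "p = (\<Sum>x\<in>S. smult (poly p x) (l x))"
    proof (rule poly_eqI_degree[of S])
      show "degree (\<Sum>x\<in>S. smult (poly p x) (l x)) < card S"
        using assms deg by (intro degree_sum_less) (auto intro: le_less_trans[OF degree_smult_le] simp: card_gt_0_iff)
      fix z assume "z \<in> S"
      then have "(\<Sum>x\<in>S. poly p x * poly (l x) z) = (\<Sum>x\<in>S. if x = z then poly p z else 0)"
        by (intro sum.cong) (auto simp: val)
      then show "poly p z = poly (\<Sum>x\<in>S. smult (poly p x) (l x)) z"
        using assms \<open>z \<in> S\<close> by (simp add: poly_sum)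
    qed (use p in auto)
    then have "coeff p j = coeff (\<Sum>x\<in>S. smult (poly p x) (l x)) j" by simp
    then show "coeff p j = (\<Sum>x\<in>S. coeff (l x) j * poly p x)"
      by (simp add: coeff_sum mult.commute)
  qed
qed

text \<open>Differentiating coefficient by coefficient avoids choosing a topology on
  polynomials.\<close>

definition has_coeff_derivative ::
    "(real \<Rightarrow> complex poly) \<Rightarrow> complex poly \<Rightarrow> real filter \<Rightarrow> bool" where
  "has_coeff_derivative p p' F \<longleftrightarrow>
     (\<forall>j. ((\<lambda>t. coeff (p t) j) has_vector_derivative coeff p' j) F)"

lemma has_coeff_derivative_mult:
  assumes "has_coeff_derivative p p' (at t within S)" "has_coeff_derivative r r' (at t within S)"
  shows "has_coeff_derivative (\<lambda>t. p t * r t) (p t * r' + p' * r t) (at t within S)"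
  using assms unfolding has_coeff_derivative_def
  by (auto simp: coeff_mult sum.distrib[symmetric] intro!: has_vector_derivative_sum has_vector_derivative_mult)

lemma has_coeff_derivative_power:
  assumes "has_coeff_derivative p p' (at t within S)"
  shows "has_coeff_derivative (\<lambda>t. p t ^ k) (of_nat k * p t ^ (k - 1) * p') (at t within S)"
proof (induction k)
  case 0
  then show ?case by (auto simp: has_coeff_derivative_def)
next
  case (Suc k)
  have "p t * (of_nat k * p t ^ (k - 1) * p') + p' * p t ^ k = of_nat (Suc k) * p t ^ k * p'"
    by (cases k) (auto simp: algebra_simps)
  then show ?case using has_coeff_derivative_mult[OF assms Suc] by simp
qed

lemma has_coeff_derivative_pCons_0_pderiv:
  assumes "has_coeff_derivative p p' (at t within S)"
  shows "has_coeff_derivative (\<lambda>t. pCons 0 (pderiv (p t))) (pCons 0 (pderiv p')) (at t within S)"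
  using assms unfolding has_coeff_derivative_def coeff_pCons_0_pderiv
  by (auto intro!: has_vector_derivative_mult_right)

text \<open>The degree bound is uniform in \<open>s\<close>, so that one finite sum represents the
  inner product at all times.\<close>

lemma has_vector_derivative_circle_inner:
  assumes "has_coeff_derivative p p' (at t within S)" "has_coeff_derivative r r' (at t within S)"
    and "\<And>s. degree (r s) \<le> n" "degree r' \<le> n"
  shows "((\<lambda>s. circle_inner (p s) (r s)) has_vector_derivative
           circle_inner (p t) r' + circle_inner p' (r t)) (at t within S)"
  unfolding circle_inner_altdef[OF assms(3)] circle_inner_altdef[OF assms(4)] sum.distrib[symmetric]
  using assms(1,2) unfolding has_coeff_derivative_def
  by (auto intro!: has_vector_derivative_sum has_vector_derivative_mult has_vector_derivative_cnj)

section \<open>Coefficient estimates\<close>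

lemma cmod_coeff_mult_le:
  fixes p r :: "complex poly"
  assumes "\<And>i. i \<le> n \<Longrightarrow> cmod (coeff p i) \<le> K" "\<And>i. i \<le> n \<Longrightarrow> cmod (coeff r i) \<le> L"
  shows "cmod (coeff (p * r) n) \<le> real (n + 1) * (K * L)"
proof -
  have "0 \<le> K" using assms(1)[of 0] norm_ge_zero order_trans by blast
  then have "cmod (coeff p i * coeff r (n - i)) \<le> K * L" if "i \<le> n" for i
    unfolding norm_mult using assms that by (intro mult_mono) auto
  then have "cmod (coeff (p * r) n) \<le> (\<Sum>i\<le>n. K * L)"
    unfolding coeff_mult by (intro sum_norm_le) auto
  then show ?thesis by (simp add: algebra_simps)
qed

lemma cmod_coeff_power_le:
  fixes p :: "complex poly"
  assumes "\<And>i. cmod (coeff p i) \<le> K" and "i \<le> n"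
  shows "cmod (coeff (p ^ k) i) \<le> (real (n + 1) * K) ^ k"
  using assms(2)
proof (induction k arbitrary: i)
  case 0
  then show ?case by (auto simp: coeff_1)
next
  case (Suc k)
  have K: "0 \<le> K" using assms(1)[of 0] norm_ge_zero order_trans by blast
  have "cmod (coeff (p * p ^ k) i) \<le> real (i + 1) * (K * (real (n + 1) * K) ^ k)"
    using assms Suc by (intro cmod_coeff_mult_le) auto
  also have "\<dots> \<le> real (n + 1) * (K * (real (n + 1) * K) ^ k)"
    using Suc K by (intro mult_right_mono) auto
  finally show ?case by (simp add: mult_ac)
qed

text \<open>Each linear factor adds a shifted copy of the coefficients, scaled by a number of
  modulus at most 1, and so at most doubles the bound.\<close>

lemma cmod_coeff_prod_linear_le:
  fixes u :: "'b \<Rightarrow> complex"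
  assumes "finite S" "\<And>k. k \<in> S \<Longrightarrow> cmod (u k) \<le> 1"
  shows "cmod (coeff (\<Prod>k\<in>S. [:1, u k:]) j) \<le> 2 ^ card S"
  using assms
proof (induction S arbitrary: j)
  case empty
  then show ?case by (auto simp: coeff_1)
next
  case (insert x S)
  let ?p = "\<Prod>k\<in>S. [:1, u k:]"
  have "cmod (u x) * cmod (coeff ?p (j - 1)) \<le> 1 * 2 ^ card S"
    using insert by (intro mult_mono) auto
  moreover have "cmod (coeff ?p j) \<le> 2 ^ card S"
    using insert by auto
  moreover have "cmod (coeff (\<Prod>k\<in>insert x S. [:1, u k:]) j)
      \<le> cmod (coeff ?p j) + cmod (u x) * cmod (coeff ?p (j - 1))"
    using insert(1,2) by (cases j) (auto simp: norm_mult[symmetric] intro: norm_triangle_ineq)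
  ultimately show ?case using insert(1,2) by simp
qed

text \<open>Pulling \<open>- w k\<close> out of each factor leaves \<open>1 - z / w k\<close> with
  \<open>1 / w k\<close> in the closed disc; the constants pulled out, together with
  \<open>c\<close>, multiply to \<open>coeff p 0\<close>.\<close>

lemma cmod_coeff_le_if_zeros_outside:
  fixes w :: "'b \<Rightarrow> complex"
  assumes "finite S" "\<And>k. k \<in> S \<Longrightarrow> cmod (w k) \<ge> 1"
    and p: "p = smult c (\<Prod>k\<in>S. [:-w k, 1:])"
  shows "cmod (coeff p j) \<le> 2 ^ card S * cmod (coeff p 0)"
proof -
  have nz: "w k \<noteq> 0" if "k \<in> S" for k using assms(2)[OF that] by auto
  have "(\<Prod>k\<in>S. [:-w k, 1:]) = (\<Prod>k\<in>S. smult (- w k) [:1, - 1 / w k:])"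
    using nz by (intro prod.cong) auto
  also have "\<dots> = smult (\<Prod>k\<in>S. - w k) (\<Prod>k\<in>S. [:1, - 1 / w k:])"
    by (rule prod_smult)
  finally have p': "p = smult (c * (\<Prod>k\<in>S. - w k)) (\<Prod>k\<in>S. [:1, - 1 / w k:])"
    by (simp add: p)
  have 0: "coeff p 0 = c * (\<Prod>k\<in>S. - w k)"
    by (simp add: p' poly_0_coeff_0[symmetric] poly_prod)
  have "cmod (coeff (\<Prod>k\<in>S. [:1, - 1 / w k:]) j) \<le> 2 ^ card S"
    using assms nz by (intro cmod_coeff_prod_linear_le) (auto simp: norm_divide)
  then have "cmod (coeff p 0) * cmod (coeff (\<Prod>k\<in>S. [:1, - 1 / w k:]) j) \<le> cmod (coeff p 0) * 2 ^ card S"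
    by (rule mult_left_mono) auto
  then show ?thesis by (simp only: 0) (simp add: p' norm_mult mult_ac)
qed

section \<open>Tracking zeros\<close>

text \<open>Picking the nearest \<open>w k t\<close> for each \<open>v i\<close> works: the distance to it is at most the
  \<open>m\<close>-th root of the product, and it is eventually a permutation because the \<open>v i\<close> are
  distinct.\<close>

lemma root_matching:
  fixes w :: "nat \<Rightarrow> real \<Rightarrow> complex" and v :: "nat \<Rightarrow> complex"
  assumes "m \<ge> 1" and inj: "inj_on v {1..m}"
    and lim: "\<And>i. i \<in> {1..m} \<Longrightarrow> ((\<lambda>t. \<Prod>k\<in>{1..m}. v i - w k t) \<longlongrightarrow> 0) at_top"
  obtains \<sigma> where "\<And>t. \<sigma> t permutes {1..m}"
    and "\<And>i. i \<in> {1..m} \<Longrightarrow> ((\<lambda>t. w (\<sigma> t i) t) \<longlongrightarrow> v i) at_top"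
proof -
  define n where "n i t = arg_min_on (\<lambda>k. cmod (v i - w k t)) {1..m}" for i t
  have ne: "finite {1..m}" "{1..m} \<noteq> {}" using assms(1) by auto
  have n: "n i t \<in> {1..m}" for i t
    unfolding n_def by (rule arg_min_if_finite(1)[OF ne])
  have n_le: "cmod (v i - w (n i t) t) \<le> cmod (v i - w k t)" if "k \<in> {1..m}" for i k t
    unfolding n_def by (rule arg_min_least[OF ne that])
  have n_lim: "((\<lambda>t. w (n i t) t) \<longlongrightarrow> v i) at_top" if i: "i \<in> {1..m}" for i
    unfolding tendsto_iff
  proof (intro allI impI)
    fix e :: real assume e: "e > 0"
    have "\<forall>\<^sub>F t in at_top. dist (\<Prod>k\<in>{1..m}. v i - w k t) 0 < e ^ m"
      by (rule tendstoD[OF lim[OF i]]) (use e in auto)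
    then show "\<forall>\<^sub>F t in at_top. dist (w (n i t) t) (v i) < e"
    proof eventually_elim
      case (elim t)
      have "cmod (v i - w (n i t) t) ^ m = (\<Prod>k\<in>{1..m}. cmod (v i - w (n i t) t))" by simp
      also have "\<dots> \<le> (\<Prod>k\<in>{1..m}. cmod (v i - w k t))"
        by (intro prod_mono) (use n_le in auto)
      also have "\<dots> < e ^ m" using elim by (simp add: prod_norm)
      finally have "cmod (v i - w (n i t) t) < e" by (rule power_less_imp_less_base) (use e in auto)
      then show ?case by (simp add: dist_norm norm_minus_commute)
    qed
  qed
  have "\<forall>\<^sub>F t in at_top. i \<noteq> j \<longrightarrow> n i t \<noteq> n j t" if ij: "i \<in> {1..m}" "j \<in> {1..m}" for i j
  proof (cases "i = j")
    case False
    then have "v i \<noteq> v j" using inj ij by (auto dest: inj_onD)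
    then have d: "dist (v i) (v j) / 2 > 0" by simp
    from tendstoD[OF n_lim[OF ij(1)] d] tendstoD[OF n_lim[OF ij(2)] d]
    show ?thesis
    proof eventually_elim
      case (elim t)
      show ?case
      proof (intro impI notI)
        assume "n i t = n j t"
        then show False
          using elim dist_triangle3[of "v i" "v j" "w (n i t) t"] by simp
      qed
    qed
  qed simp
  then have "\<forall>\<^sub>F t in at_top. \<forall>i\<in>{1..m}. \<forall>j\<in>{1..m}. i \<noteq> j \<longrightarrow> n i t \<noteq> n j t"
    by (intro eventually_ball_finite ballI) auto
  then have ev_inj: "\<forall>\<^sub>F t in at_top. inj_on (\<lambda>i. n i t) {1..m}"
    by eventually_elim (auto simp: inj_on_def)
  define \<sigma> where "\<sigma> t i = (if inj_on (\<lambda>i. n i t) {1..m} \<and> i \<in> {1..m} then n i t else i)" for t i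
  show ?thesis
  proof (rule that)
    fix t show "\<sigma> t permutes {1..m}"
    proof (cases "inj_on (\<lambda>i. n i t) {1..m}")
      case True
      have "(\<lambda>i. n i t) ` {1..m} = {1..m}"
        by (rule endo_inj_surj[OF _ _ True]) (use n in auto)
      with True have "bij_betw (\<lambda>i. n i t) {1..m} {1..m}" by (simp add: bij_betw_def)
      then have "bij_betw (\<sigma> t) {1..m} {1..m}"
        using True by (subst bij_betw_cong[of _ _ "\<lambda>i. n i t"]) (auto simp: \<sigma>_def)
      then show ?thesis by (rule bij_imp_permutes) (auto simp: \<sigma>_def)
    next
      case False
      then have "\<sigma> t = id" by (auto simp: \<sigma>_def fun_eq_iff)
      then show ?thesis by (simp add: permutes_id)
    qed
  next
    fix i assume i: "i \<in> {1..m}"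
    have "\<forall>\<^sub>F t in at_top. w (n i t) t = w (\<sigma> t i) t"
      using ev_inj by eventually_elim (use i in \<open>auto simp: \<sigma>_def\<close>)
    then show "((\<lambda>t. w (\<sigma> t i) t) \<longlongrightarrow> v i) at_top"
      using n_lim[OF i] by (rule Lim_transform_eventually[rotated])
  qed
qed

lemma has_vector_derivative_iff_tendsto:
  "(f has_vector_derivative D) (at t) \<longleftrightarrow> ((\<lambda>s. (f s - f t) /\<^sub>R (s - t)) \<longlongrightarrow> D) (at t)"
proof -
  have "\<forall>\<^sub>F s in at t. norm (f s - f t - (s - t) *\<^sub>R D) / norm (s - t) = norm ((f s - f t) /\<^sub>R (s - t) - D)"
    using eventually_neq_at_within[of t]
  proof eventually_elim
    case (elim s)
    then have "(f s - f t) /\<^sub>R (s - t) - D = (f s - f t - (s - t) *\<^sub>R D) /\<^sub>R (s - t)"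
      by (simp add: scaleR_right_diff_distrib)
    then show ?case by (simp add: divide_inverse mult.commute)
  qed
  then have "((\<lambda>s. norm (f s - f t - (s - t) *\<^sub>R D) / norm (s - t)) \<longlongrightarrow> 0) (at t)
      \<longleftrightarrow> ((\<lambda>s. norm ((f s - f t) /\<^sub>R (s - t) - D)) \<longlongrightarrow> 0) (at t)"
    by (rule tendsto_cong)
  then show ?thesis
    by (simp add: has_vector_derivative_def has_derivative_iff_norm bounded_linear_scaleR_left
        tendsto_norm_zero_iff LIM_zero_iff)
qed

text \<open>Write \<open>P s z = L * (\<Prod>k. z - x k s)\<close>. Since \<open>P s (x i t) = (x i t - x i s) * R s\<close> with
  \<open>R\<close> bounded away from \<open>0\<close>, differentiability of \<open>P\<close> in \<open>s\<close> at the fixed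
  point \<open>x i t\<close> first gives continuity and then differentiability of the root \<open>x i\<close>.\<close>

lemma separated_root_has_vector_derivative:
  fixes x :: "nat \<Rightarrow> real \<Rightarrow> complex" and P :: "real \<Rightarrow> complex \<Rightarrow> complex"
  assumes i: "i \<in> {1..m}" and L: "L \<noteq> 0" and d: "d > 0"
    and P: "\<forall>\<^sub>F s in nhds t. \<forall>z. P s z = L * (\<Prod>k\<in>{1..m}. z - x k s)"
    and sep: "\<forall>\<^sub>F s in nhds t. \<forall>i\<in>{1..m}. \<forall>k\<in>{1..m}. i \<noteq> k \<longrightarrow> cmod (x i t - x k s) \<ge> d"
    and D: "\<And>k. k \<in> {1..m} \<Longrightarrow> ((\<lambda>s. P s (x k t)) has_vector_derivative D k) (at t)"
  shows "(x i has_vector_derivative - D i / (L * (\<Prod>k\<in>{1..m}-{i}. x i t - x k t))) (at t)"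
proof -
  define R where "R j s = L * (\<Prod>k\<in>{1..m}-{j}. x j t - x k s)" for j s
  define c where "c = cmod L * d ^ (m - 1)"
  have c: "c > 0" using L d by (simp add: c_def)
  have split: "\<forall>\<^sub>F s in nhds t. P s (x j t) = (x j t - x j s) * R j s" if "j \<in> {1..m}" for j
    using P
  proof eventually_elim
    case (elim s)
    have "(\<Prod>k\<in>{1..m}. x j t - x k s) = (x j t - x j s) * (\<Prod>k\<in>{1..m}-{j}. x j t - x k s)"
      by (rule prod.remove) (use that in auto)
    then show ?case using elim by (simp only: R_def mult.left_commute)
  qed
  have R_ge: "\<forall>\<^sub>F s in nhds t. cmod (R j s) \<ge> c" if j: "j \<in> {1..m}" for j
    using sep
  proof eventually_elim
    case (elim s)
    have "d ^ (m - 1) = (\<Prod>k\<in>{1..m}-{j}. d)" using j by simp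
    also have "\<dots> \<le> (\<Prod>k\<in>{1..m}-{j}. cmod (x j t - x k s))"
      by (intro prod_mono) (use elim j d in auto)
    finally show ?case by (simp add: R_def c_def norm_mult prod_norm mult_left_mono)
  qed
  have P0: "P t (x j t) = 0" if "j \<in> {1..m}" for j
    using eventually_nhds_x_imp_x[OF split[OF that]] by simp
  \<comment> \<open>Continuity is shown for every root, because \<open>R i\<close> involves all the
    roots other than \<open>x i\<close>.\<close>
  have cont: "isCont (x j) t" if j: "j \<in> {1..m}" for j
  proof -
    have "((\<lambda>s. P s (x j t)) \<longlongrightarrow> P t (x j t)) (at t)"
      using has_vector_derivative_continuous[OF D[OF j]] by (simp add: isCont_def)
    then have "((\<lambda>s. cmod (P s (x j t)) / c) \<longlongrightarrow> cmod (P t (x j t)) / c) (at t)"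
      by (intro tendsto_intros) (use c in auto)
    then have lim: "((\<lambda>s. cmod (P s (x j t)) / c) \<longlongrightarrow> 0) (at t)" by (simp add: P0[OF j])
    have "\<forall>\<^sub>F s in nhds t. cmod (x j s - x j t) \<le> cmod (P s (x j t)) / c"
      using split[OF j] R_ge[OF j]
    proof eventually_elim
      case (elim s)
      then have "cmod (x j t - x j s) * c \<le> cmod (P s (x j t))"
        by (simp add: norm_mult mult_left_mono)
      then show ?case using c by (simp add: field_simps norm_minus_commute)
    qed
    then have "((\<lambda>s. x j s - x j t) \<longlongrightarrow> 0) (at t)"
      by (intro Lim_null_comparison[OF _ lim]) (auto simp: eventually_nhds_conv_at)
    then show ?thesis by (simp add: isCont_def LIM_zero_iff)
  qed
  have "isCont (R i) t"
    unfolding R_def by (intro continuous_intros cont) auto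
  moreover have Rt: "R i t \<noteq> 0" using eventually_nhds_x_imp_x[OF R_ge[OF i]] c by auto
  ultimately have R_lim: "((\<lambda>s. R i s) \<longlongrightarrow> R i t) (at t)" by (simp add: isCont_def)
  have "((\<lambda>s. (P s (x i t) - P t (x i t)) /\<^sub>R (s - t)) \<longlongrightarrow> D i) (at t)"
    using D[OF i] by (simp add: has_vector_derivative_iff_tendsto)
  then have "((\<lambda>s. - ((P s (x i t) - P t (x i t)) /\<^sub>R (s - t)) / R i s) \<longlongrightarrow> - D i / R i t) (at t)"
    by (intro tendsto_intros R_lim Rt) 
  moreover have "\<forall>\<^sub>F s in at t. - ((P s (x i t) - P t (x i t)) /\<^sub>R (s - t)) / R i s = (x i s - x i t) /\<^sub>R (s - t)"
  proof -
    have "\<forall>\<^sub>F s in nhds t. - ((P s (x i t) - P t (x i t)) /\<^sub>R (s - t)) / R i s = (x i s - x i t) /\<^sub>R (s - t)"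
      using split[OF i] R_ge[OF i]
    proof eventually_elim
      case (elim s)
      then have "R i s \<noteq> 0" using c by auto
      moreover have "P s (x i t) - P t (x i t) = - ((x i s - x i t) * R i s)"
        using elim by (simp add: P0[OF i] algebra_simps)
      ultimately show ?case by (simp add: scaleR_conv_of_real)
    qed
    then show ?thesis by (simp add: eventually_nhds_conv_at)
  qed
  ultimately have "((\<lambda>s. (x i s - x i t) /\<^sub>R (s - t)) \<longlongrightarrow> - D i / R i t) (at t)"
    by (rule Lim_transform_eventually)
  then show ?thesis
    by (simp add: has_vector_derivative_iff_tendsto R_def)
qed

text \<open>Room for perturbation: points within \<open>d\<close> of the \<open>v i\<close> keep
  modulus at least \<open>d\<close> and mutual distances at least \<open>d\<close>, which explains
  the factors 2 and 3.\<close>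

lemma min_distance_pos:
  fixes v :: "nat \<Rightarrow> complex"
  assumes "inj_on v {1..m}" "\<And>i. i \<in> {1..m} \<Longrightarrow> v i \<noteq> 0"
  obtains d where "d > 0" "\<And>i. i \<in> {1..m} \<Longrightarrow> 2 * d \<le> cmod (v i)"
    "\<And>i k. i \<in> {1..m} \<Longrightarrow> k \<in> {1..m} \<Longrightarrow> i \<noteq> k \<Longrightarrow> 3 * d \<le> cmod (v i - v k)"
proof -
  \<comment> \<open>Each of the finitely many conditions holds for all small positive
    \<open>d\<close>, so a common \<open>d\<close> exists.\<close>
  have ev: "\<forall>\<^sub>F d::real in at_right 0. n * d \<le> c" if "n > 0" "c > 0" for n c
    unfolding eventually_at_right_field using that
    by (intro exI[of _ "c / n"]) (auto simp: field_simps)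
  have "\<forall>\<^sub>F d in at_right 0. (\<forall>i\<in>{1..m}. 2 * d \<le> cmod (v i)) \<and>
      (\<forall>i\<in>{1..m}. \<forall>k\<in>{1..m}. i \<noteq> k \<longrightarrow> 3 * d \<le> cmod (v i - v k)) \<and> d > 0"
  proof (intro eventually_conj eventually_ball_finite ballI finite_atLeastAtMost)
    fix i assume i: "i \<in> {1..m}"
    show "\<forall>\<^sub>F d in at_right 0. 2 * d \<le> cmod (v i)"
      by (rule ev) (use assms(2)[OF i] in auto)
    fix k assume k: "k \<in> {1..m}"
    show "\<forall>\<^sub>F d in at_right 0. i \<noteq> k \<longrightarrow> 3 * d \<le> cmod (v i - v k)"
    proof (cases "i = k")
      case False
      then have "v i \<noteq> v k" using assms(1) i k by (auto dest: inj_onD)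
      then have "\<forall>\<^sub>F d in at_right 0. 3 * d \<le> cmod (v i - v k)" by (intro ev) auto
      then show ?thesis by eventually_elim simp
    qed simp
  qed (simp add: eventually_at_right_less)
  from eventually_happens[OF this] show ?thesis using that by auto
qed

section \<open>Conservation of the moments\<close>

locale polynomial_solution =
  fixes m :: nat and a :: "nat \<Rightarrow> real \<Rightarrow> complex" and f :: "real \<Rightarrow> complex poly"
    and q :: "real \<Rightarrow> real" and \<omega> :: "nat \<Rightarrow> real \<Rightarrow> complex"
  assumes m_pos: "m \<ge> 1"
    and f_eq: "\<And>t. t \<ge> 0 \<Longrightarrow> f t = (\<Sum>j=1..m+1. monom (a j t) j)"
    and sol: "global_locally_univalent_solution q (\<lambda>\<zeta> t. poly (f t) \<zeta>)"
    and lead_0: "a (m + 1) 0 \<noteq> 0"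
    and q_pos: "\<And>t. t \<ge> 0 \<Longrightarrow> q t > 0"
    and q_integral: "filterlim (\<lambda>t. integral {0..t} q) at_top at_top"
    and zeros: "\<And>t. t \<ge> 0 \<Longrightarrow>
        proots (pderiv (f t)) = image_mset (\<lambda>k. \<omega> k t) (mset_set {1..m})"
begin

definition a' :: "nat \<Rightarrow> real \<Rightarrow> complex" where
  "a' j t = vector_derivative (a j) (at t within {0..})"

definition ft :: "real \<Rightarrow> complex poly" where
  "ft t = (\<Sum>j=1..m+1. monom (a' j t) j)"

lemma coeff_f: "t \<ge> 0 \<Longrightarrow> coeff (f t) j = (if j \<in> {1..m+1} then a j t else 0)"
  by (simp add: f_eq coeff_sum)

lemma coeff_ft: "coeff (ft t) j = (if j \<in> {1..m+1} then a' j t else 0)"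
  by (simp add: ft_def coeff_sum)

lemma degree_f_le: "t \<ge> 0 \<Longrightarrow> degree (f t) \<le> m + 1"
  by (intro degree_le) (auto simp: coeff_f)

lemma degree_ft_le: "degree (ft t) \<le> m + 1"
  by (intro degree_le) (auto simp: coeff_ft)

lemma at_within_half_line_neq_bot:
  assumes "t \<ge> 0"
  shows "at t within {0::real..} \<noteq> bot"
proof -
  have "{t<..} \<subseteq> {0..}" using assms by auto
  then have "at_right t \<le> at t within {0..}" by (rule at_le)
  then show ?thesis using trivial_limit_at_right_real[of t] by (auto simp: bot_unique)
qed

text \<open>Interpolation at \<open>m + 2\<close> points of the closed disc, one more than the
  degree bound, writes \<open>a j\<close> as a fixed combination of values of \<open>f\<close>, each
  differentiable in time.\<close>

lemma a_has_vector_derivative: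
  assumes "t \<ge> 0" "j \<in> {1..m+1}"
  shows "(a j has_vector_derivative a' j t) (at t within {0..})"
proof -
  have "infinite (cball (0::complex) 1)"
    using uncountable_cball[of 1 "0 :: complex"] countable_finite by auto
  then obtain S :: "complex set" where S: "finite S" "card S = m + 2" "S \<subseteq> cball 0 1"
    using infinite_arbitrarily_large by blast
  then have "S \<noteq> {}" by auto
  with S(1) obtain c where c: "\<And>p. degree p < card S \<Longrightarrow> coeff p j = (\<Sum>x\<in>S. c x * poly p x)"
    using coeff_as_combination_of_values by blast
  have "(\<lambda>s. \<Sum>x\<in>S. c x * poly (f s) x) differentiable (at t within {0..})"
    using sol S assms unfolding global_locally_univalent_solution_def smooth_in_time_def
    by (intro differentiable_sum differentiable_mult differentiable_const) auto
  moreover have "a j s = (\<Sum>x\<in>S. c x * poly (f s) x)" if "s \<ge> 0" for s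
    using c[of "f s"] degree_f_le[OF that] coeff_f[OF that, of j] assms S by simp
  ultimately obtain D where
    "((\<lambda>s. \<Sum>x\<in>S. c x * poly (f s) x) has_vector_derivative D) (at t within {0..})"
    and aj: "\<And>s. s \<ge> 0 \<Longrightarrow> a j s = (\<Sum>x\<in>S. c x * poly (f s) x)"
    unfolding vector_derivative_works by blast
  then have "(a j has_vector_derivative D) (at t within {0..})"
    using has_vector_derivative_transform[of t "{0..}" "a j"] assms by force
  then show ?thesis
    unfolding a'_def using differentiableI_vector vector_derivative_works by blast
qed

lemma has_coeff_derivative_f:
  assumes "t \<ge> 0"
  shows "has_coeff_derivative f (ft t) (at t within {0..})"
  unfolding has_coeff_derivative_def
proof
  fix j
  have "((\<lambda>s. if j \<in> {1..m+1} then a j s else 0) has_vector_derivative coeff (ft t) j) (at t within {0..})"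
    using a_has_vector_derivative[OF assms, of j] by (auto simp: coeff_ft)
  then show "((\<lambda>s. coeff (f s) j) has_vector_derivative coeff (ft t) j) (at t within {0..})"
    by (rule has_vector_derivative_transform[rotated 2]) (use assms in \<open>auto simp: coeff_f\<close>)
qed

lemma time_deriv_f:
  assumes "t \<ge> 0"
  shows "time_deriv (\<lambda>\<zeta> t. poly (f t) \<zeta>) z t = poly (ft t) z"
proof -
  have "((\<lambda>s. \<Sum>j=1..m+1. a j s * z ^ j) has_vector_derivative (\<Sum>j=1..m+1. a' j t * z ^ j)) (at t within {0..})"
    by (intro has_vector_derivative_sum has_vector_derivative_mult_left a_has_vector_derivative assms) auto
  then have "((\<lambda>s. poly (f s) z) has_vector_derivative (\<Sum>j=1..m+1. a' j t * z ^ j)) (at t within {0..})"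
    by (rule has_vector_derivative_transform[rotated 2]) (use assms in \<open>auto simp: f_eq poly_sum poly_monom\<close>)
  then show ?thesis
    unfolding time_deriv_def
    by (subst vector_derivative_within[OF at_within_half_line_neq_bot[OF assms]])
       (auto simp: ft_def poly_sum poly_monom)
qed

lemma circle_inner_f:
  assumes "t \<ge> 0"
  shows "circle_inner (h * ft t) (pCons 0 (pderiv (f t))) + circle_inner (h * pCons 0 (pderiv (f t))) (ft t)
           = 2 * of_real (q t) * coeff h 0"
proof (rule circle_inner_polubarinova_galin)
  fix z :: complex assume "cmod z = 1"
  then have "Re (time_deriv (\<lambda>\<zeta> t. poly (f t) \<zeta>) z t
      * cnj (z * space_deriv (\<lambda>\<zeta> t. poly (f t) \<zeta>) z t)) = q t"
    using sol assms unfolding global_locally_univalent_solution_def polubarinova_galin_def by simp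
  then show "Re (poly (ft t) z * cnj (z * poly (pderiv (f t)) z)) = q t"
    by (simp only: time_deriv_f[OF assms] space_deriv_def DERIV_imp_deriv[OF poly_DERIV])
qed

definition moment :: "nat \<Rightarrow> real \<Rightarrow> complex" where
  "moment k t = circle_inner (f t ^ k * pCons 0 (pderiv (f t))) (f t)"

lemma moment_eq_sum:
  "t \<ge> 0 \<Longrightarrow> moment k t = (\<Sum>j\<le>m+1. coeff (f t ^ k * pCons 0 (pderiv (f t))) j * cnj (coeff (f t) j))"
  unfolding moment_def by (rule circle_inner_altdef) (rule degree_f_le)

text \<open>In the product rule, the terms that differentiate \<open>f ^ k * z * f'\<close> combine
  to \<open>z * d/dz\<close> of \<open>f ^ k * ft\<close>. Self-adjointness moves this operator onto
  the second argument, and the weak equation with test polynomial \<open>f ^ k\<close> applies.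
  Since \<open>f\<close> vanishes at 0, the constant term of \<open>f ^ k\<close> is
  \<open>0 ^ k\<close>, which is 1 only for \<open>k = 0\<close>.\<close>

lemma moment_has_vector_derivative:
  assumes t: "t \<ge> 0"
  shows "(moment k has_vector_derivative 2 * of_real (q t) * 0 ^ k) (at t within {0..})"
proof -
  let ?D = "\<lambda>p. pCons 0 (pderiv p)"
  \<comment> \<open>\<open>f\<close> is unconstrained at negative times; \<open>g\<close> has bounded degree everywhere.\<close>
  define g where "g s = f (max s 0)" for s
  have g: "g s = f s" if "s \<ge> 0" for s using that by (simp add: g_def)
  have pd: "pderiv (g t ^ k * ft t) = g t ^ k * pderiv (ft t) + of_nat k * g t ^ (k - 1) * ft t * pderiv (g t)"
    by (simp add: pderiv_mult pderiv_power of_nat_poly algebra_simps)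
  have "has_coeff_derivative g (ft t) (at t within {0..})"
    unfolding has_coeff_derivative_def
  proof
    fix j show "((\<lambda>s. coeff (g s) j) has_vector_derivative coeff (ft t) j) (at t within {0..})"
      by (rule has_vector_derivative_transform[rotated 2, where f = "\<lambda>s. coeff (f s) j"])
         (use t has_coeff_derivative_f[OF t] in \<open>auto simp: g has_coeff_derivative_def\<close>)
  qed
  moreover have deg: "degree (g s) \<le> m + 1" for s
    unfolding g_def by (intro degree_f_le) auto
  ultimately have "((\<lambda>s. circle_inner (g s ^ k * ?D (g s)) (g s)) has_vector_derivative
      circle_inner (g t ^ k * ?D (g t)) (ft t)
      + circle_inner (g t ^ k * ?D (ft t) + of_nat k * g t ^ (k - 1) * ft t * ?D (g t)) (g t)) (at t within {0..})"
    by (intro has_vector_derivative_circle_inner[where n = "m + 1"] has_coeff_derivative_mult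
          has_coeff_derivative_power has_coeff_derivative_pCons_0_pderiv degree_ft_le)
       (use deg in auto)
  also have "g t ^ k * ?D (ft t) + of_nat k * g t ^ (k - 1) * ft t * ?D (g t) = ?D (g t ^ k * ft t)"
    by (simp add: pd)
  also have "circle_inner (g t ^ k * ?D (g t)) (ft t) + circle_inner (?D (g t ^ k * ft t)) (g t)
       = 2 * of_real (q t) * coeff (g t ^ k) 0"
    using circle_inner_f[OF t, of "g t ^ k"] t
    by (simp add: circle_inner_pderiv_commute g add.commute del: pCons_0_0)
  also have "coeff (g t ^ k) 0 = 0 ^ k"
    using t by (simp add: coeff_0_power g coeff_f)
  finally show ?thesis
    by (rule has_vector_derivative_transform[rotated 2]) (use t in \<open>auto simp: g moment_def\<close>)
qed

lemma moment_constant: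
  assumes "t \<ge> 0" "k \<ge> 1"
  shows "moment k t = moment k 0"
proof -
  obtain c where "\<And>s. s \<in> {0..} \<Longrightarrow> moment k s = c"
    using has_vector_derivative_zero_constant[of "{0::real..}" "moment k"] moment_has_vector_derivative[of _ k] assms
    by (auto simp: power_0_left)
  then show ?thesis using assms by auto
qed

lemma moment_0:
  assumes "t \<ge> 0"
  shows "moment 0 t = moment 0 0 + 2 * of_real (integral {0..t} q)"
proof -
  have "((\<lambda>s. 2 * complex_of_real (q s)) has_integral moment 0 t - moment 0 0) {0..t}"
    using assms moment_has_vector_derivative[of _ 0]
    by (intro fundamental_theorem_of_calculus)
       (auto intro!: has_vector_derivative_within_subset[of "moment 0" _ _ "{0..}" "{0..t}"] simp del: of_real_mult)
  then have "((\<lambda>s. Re (2 * complex_of_real (q s))) has_integral Re (moment 0 t - moment 0 0)) {0..t}"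
   and *: "((\<lambda>s. Im (2 * complex_of_real (q s))) has_integral Im (moment 0 t - moment 0 0)) {0..t}"
    using has_integral_linear[OF _ bounded_linear_Re] has_integral_linear[OF _ bounded_linear_Im]
    unfolding o_def by blast+
  then have "((\<lambda>s. 1/2 * (2 * q s)) has_integral 1/2 * Re (moment 0 t - moment 0 0)) {0..t}"
    by (intro has_integral_mult_right) simp
  then have "integral {0..t} q = Re (moment 0 t - moment 0 0) / 2"
    by (simp add: integral_unique)
  moreover have "Im (moment 0 t - moment 0 0) = 0"
    using has_integral_unique[OF *, of 0] by simp
  ultimately show ?thesis by (simp add: complex_eq_iff)
qed

section \<open>Decay of the coefficients\<close>

definition A :: "real \<Rightarrow> real" where "A t = Re (a 1 t)"

lemma poly_pderiv_f_neq_0: "t \<ge> 0 \<Longrightarrow> cmod z \<le> 1 \<Longrightarrow> poly (pderiv (f t)) z \<noteq> 0"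
  using sol by (auto simp: global_locally_univalent_solution_def space_deriv_def
      DERIV_imp_deriv[OF poly_DERIV])

lemma coeff_pderiv_f_0: "t \<ge> 0 \<Longrightarrow> coeff (pderiv (f t)) 0 = a 1 t"
  by (simp add: coeff_pderiv coeff_f)

lemma a_1_eq: assumes "t \<ge> 0" shows "a 1 t = of_real (A t)" "A t > 0"
proof -
  have "space_deriv (\<lambda>\<zeta> t. poly (f t) \<zeta>) 0 t = a 1 t"
    using coeff_pderiv_f_0[OF assms]
    by (simp add: space_deriv_def DERIV_imp_deriv[OF poly_DERIV] poly_0_coeff_0)
  then have "a 1 t \<in> \<real>" "0 < Re (a 1 t)"
    using sol assms by (auto simp: global_locally_univalent_solution_def)
  then show "a 1 t = of_real (A t)" "A t > 0" by (auto simp: A_def)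
qed

lemma pderiv_f_eq_prod:
  assumes "t \<ge> 0"
  shows "pderiv (f t) = smult (lead_coeff (pderiv (f t))) (\<Prod>k\<in>{1..m}. [:- \<omega> k t, 1:])"
  using complex_poly_decompose_multiset[of "pderiv (f t)"]
  by (simp add: zeros[OF assms] prod_unfold_prod_mset image_mset.compositionality o_def)

lemma zeros_outside:
  assumes "t \<ge> 0" "k \<in> {1..m}"
  shows "cmod (\<omega> k t) > 1"
proof -
  have "poly (pderiv (f t)) (\<omega> k t) = 0"
    using assms by (subst pderiv_f_eq_prod) (auto simp: poly_prod)
  then show ?thesis using poly_pderiv_f_neq_0[OF assms(1), of "\<omega> k t"] by force
qed

lemma cmod_coeff_pderiv_f_le:
  assumes "t \<ge> 0"
  shows "cmod (coeff (pderiv (f t)) j) \<le> 2 ^ m * A t"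
  using cmod_coeff_le_if_zeros_outside[OF _ _ pderiv_f_eq_prod[OF assms], of j]
    zeros_outside[OF assms] a_1_eq[OF assms] coeff_pderiv_f_0[OF assms]
  by (auto simp: less_imp_le)

lemma cmod_coeff_f_le:
  assumes "t \<ge> 0"
  shows "cmod (coeff (f t) j) \<le> 2 ^ m * A t"
proof (cases j)
  case 0
  then show ?thesis using a_1_eq[OF assms] by (simp add: coeff_f[OF assms])
next
  case (Suc i)
  have "1 * cmod (coeff (f t) j) \<le> real j * cmod (coeff (f t) j)"
    using Suc by (intro mult_right_mono) auto
  also have "\<dots> \<le> 2 ^ m * A t"
    using cmod_coeff_pderiv_f_le[OF assms, of i] Suc
    by (simp add: coeff_pderiv norm_mult del: of_nat_Suc)
  finally show ?thesis by simp
qed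

text \<open>With \<open>f = z * g\<close>, the polynomial is
  \<open>z ^ (k + 1) * g ^ k * f'\<close>, and both \<open>g\<close> and \<open>f'\<close> have
  constant term \<open>a 1\<close>.\<close>

lemma coeff_moment_poly:
  assumes t: "t \<ge> 0"
  shows "j \<le> k \<Longrightarrow> coeff (f t ^ k * pCons 0 (pderiv (f t))) j = 0"
    and "coeff (f t ^ k * pCons 0 (pderiv (f t))) (k + 1) = a 1 t ^ (k + 1)"
    and "j \<le> m + 1 \<Longrightarrow> cmod (coeff (f t ^ k * pCons 0 (pderiv (f t))) j) \<le> (real (m + 2) * 2 ^ m) ^ (k + 1) * A t ^ (k + 1)"
proof -
  obtain c g where cg: "f t = pCons c g" by (rule pCons_cases)
  moreover have "c = 0" using coeff_f[OF t, of 0] by (simp add: cg)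
  ultimately have g: "f t = pCons 0 g" by simp
  have X: "pCons 0 p = monom 1 1 * p" for p :: "complex poly"
    by (simp add: monom_Suc monom_0)
  have "f t ^ k * pCons 0 d = monom 1 1 ^ (k + 1) * (g ^ k * d)" for d
    unfolding g X power_mult_distrib by (simp add: mult_ac)
  then have "f t ^ k * pCons 0 d = monom 1 (k + 1) * (g ^ k * d)" for d
    by (simp only: monom_power) simp
  then have *: "coeff (f t ^ k * pCons 0 (pderiv (f t))) j
      = (if j < k + 1 then 0 else coeff (g ^ k * pderiv (f t)) (j - (k + 1)))" for j
    by (simp add: coeff_monom_mult)
  show "j \<le> k \<Longrightarrow> coeff (f t ^ k * pCons 0 (pderiv (f t))) j = 0"
    unfolding * by simp
  have "coeff g 0 = a 1 t" using coeff_f[OF t, of 1] by (simp add: g)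
  then show "coeff (f t ^ k * pCons 0 (pderiv (f t))) (k + 1) = a 1 t ^ (k + 1)"
    unfolding * using coeff_pderiv_f_0[OF t] by (simp add: coeff_mult_0 coeff_0_power)
  let ?K = "2 ^ m * A t" and ?N = "real (m + 2)"
  have K: "?K \<ge> 0" using a_1_eq[OF t] by simp
  have gi: "cmod (coeff g i) \<le> ?K" for i
    using cmod_coeff_f_le[OF t, of "Suc i"] by (simp add: g)
  have bound: "cmod (coeff (g ^ k * pderiv (f t)) n) \<le> (?N * ?K) ^ (k + 1)" if "n \<le> m + 1" for n
  proof -
    have "cmod (coeff (g ^ k * pderiv (f t)) n) \<le> real (n + 1) * ((real (m + 1 + 1) * ?K) ^ k * ?K)"
      using gi that a_1_eq(2)[OF t] by (intro cmod_coeff_mult_le cmod_coeff_pderiv_f_le[OF t] cmod_coeff_power_le) auto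
    also have "\<dots> \<le> ?N * ((?N * ?K) ^ k * ?K)"
      using that K a_1_eq(2)[OF t] by (intro mult_mono) auto
    finally show ?thesis by (simp add: mult_ac)
  qed
  show "j \<le> m + 1 \<Longrightarrow> cmod (coeff (f t ^ k * pCons 0 (pderiv (f t))) j) \<le> (real (m + 2) * 2 ^ m) ^ (k + 1) * A t ^ (k + 1)"
    unfolding * using bound[of "j - (k + 1)"] a_1_eq[OF t] by (auto simp: power_mult_distrib mult_ac)
qed

text \<open>The moments form a triangular system: conjugates of index up to \<open>k\<close> drop
  out, so \<open>a (k + 1)\<close> can be isolated with the nonzero factor
  \<open>a 1 ^ (k + 1)\<close>.\<close>

lemma moment_eq:
  assumes t: "t \<ge> 0" and k: "k \<le> m"
  shows "moment k t = a 1 t ^ (k + 1) * cnj (a (k + 1) t)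
     + (\<Sum>j\<in>{k+2..m+1}. coeff (f t ^ k * pCons 0 (pderiv (f t))) j * cnj (a j t))"
proof -
  have "moment k t = (\<Sum>j\<in>{k+1..m+1}. coeff (f t ^ k * pCons 0 (pderiv (f t))) j * cnj (coeff (f t) j))"
    unfolding moment_eq_sum[OF t]
    by (intro sum.mono_neutral_right) (use coeff_moment_poly(1)[OF t] in auto)
  also have "\<dots> = (\<Sum>j\<in>{k+1..m+1}. coeff (f t ^ k * pCons 0 (pderiv (f t))) j * cnj (a j t))"
    by (intro sum.cong) (auto simp: coeff_f[OF t])
  also have "{k+1..m+1} = insert (k+1) {k+2..m+1}" using k by auto
  finally show ?thesis using coeff_moment_poly(2)[OF t, of k] by simp
qed

lemma moment_top: "t \<ge> 0 \<Longrightarrow> moment m t = a 1 t ^ (m + 1) * cnj (a (m + 1) t)"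
  by (subst moment_eq) auto

lemma moment_top_neq_0: "moment m 0 \<noteq> 0"
  using moment_top[of 0] lead_0 a_1_eq[of 0] by auto

text \<open>Downward induction on \<open>j\<close>: the moment \<open>M\<^sub>j\<^sub>-\<^sub>1\<close> determines \<open>a\<^sub>j\<close> in terms of the
  higher coefficients.\<close>

lemma coefficient_decay_aux:
  assumes "j \<in> {2..m+1}"
  shows "\<exists>B. \<forall>t\<ge>0. A t \<ge> 1 \<longrightarrow> cmod (a j t) * A t ^ j \<le> B"
  using assms
proof (induction "m + 1 - j" arbitrary: j rule: less_induct)
  case less
  define k where "k = j - 1"
  have k: "j = k + 1" "k \<le> m" "k \<ge> 1" using less.prems by (auto simp: k_def)
  have "\<forall>i\<in>{j+1..m+1}. \<exists>B. \<forall>t\<ge>0. A t \<ge> 1 \<longrightarrow> cmod (a i t) * A t ^ i \<le> B"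
    using less.prems by (intro ballI less.hyps) auto
  then obtain B where B: "\<And>i t. i \<in> {j+1..m+1} \<Longrightarrow> t \<ge> 0 \<Longrightarrow> A t \<ge> 1 \<Longrightarrow> cmod (a i t) * A t ^ i \<le> B i"
    by metis
  define C where "C = (real (m + 2) * 2 ^ m) ^ (k + 1)"
  have C: "C \<ge> 0" by (simp add: C_def)
  show ?case
  proof (intro exI allI impI)
    fix t assume t: "t \<ge> 0" and A1: "A t \<ge> 1"
    let ?c = "coeff (f t ^ k * pCons 0 (pderiv (f t)))"
    have "cmod (?c i * cnj (a i t)) \<le> C * B i" if i: "i \<in> {j+1..m+1}" for i
    proof -
      have "cmod (?c i * cnj (a i t)) \<le> (C * A t ^ (k + 1)) * cmod (a i t)"
        unfolding norm_mult C_def using coeff_moment_poly(3)[OF t, of i k] i A1 by (intro mult_mono) auto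
      \<comment> \<open>As \<open>i > k + 1\<close> and \<open>A t >= 1\<close>, the power may be
        raised to the weight used in the induction hypothesis.\<close>
      also have "\<dots> \<le> (C * A t ^ i) * cmod (a i t)"
        using i A1 C by (intro mult_right_mono mult_left_mono power_increasing) (auto simp: k)
      also have "\<dots> = C * (cmod (a i t) * A t ^ i)" by simp
      also have "\<dots> \<le> C * B i"
        using B[OF i t A1] C by (intro mult_left_mono)
      finally show ?thesis .
    qed
    then have S: "cmod (\<Sum>i\<in>{k+2..m+1}. ?c i * cnj (a i t)) \<le> (\<Sum>i\<in>{k+2..m+1}. C * B i)"
      by (intro sum_norm_le) (auto simp: k)
    have "cmod (a j t) * A t ^ j = cmod (a 1 t ^ (k + 1) * cnj (a (k + 1) t))"
      using a_1_eq[OF t] by (simp add: k norm_mult norm_power)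
    also have "a 1 t ^ (k + 1) * cnj (a (k + 1) t) = moment k 0 - (\<Sum>i\<in>{k+2..m+1}. ?c i * cnj (a i t))"
      using moment_eq[OF t k(2)] moment_constant[OF t k(3)] by simp
    also have "cmod \<dots> \<le> cmod (moment k 0) + cmod (\<Sum>i\<in>{k+2..m+1}. ?c i * cnj (a i t))"
      by (rule norm_triangle_ineq4)
    finally show "cmod (a j t) * A t ^ j \<le> cmod (moment k 0) + (\<Sum>i\<in>{k+2..m+1}. C * B i)"
      using S by linarith
  qed
qed

lemma coefficient_decay:
  obtains B where "B > 0" "\<And>j t. j \<in> {2..m+1} \<Longrightarrow> t \<ge> 0 \<Longrightarrow> A t \<ge> 1 \<Longrightarrow> cmod (a j t) * A t ^ j \<le> B"
proof -
  obtain B where B: "\<And>j t. j \<in> {2..m+1} \<Longrightarrow> t \<ge> 0 \<Longrightarrow> A t \<ge> 1 \<Longrightarrow> cmod (a j t) * A t ^ j \<le> B j"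
    using coefficient_decay_aux by metis
  show ?thesis
  proof (rule that[of "1 + (\<Sum>j\<in>{2..m+1}. \<bar>B j\<bar>)"])
    show "0 < 1 + (\<Sum>j\<in>{2..m+1}. \<bar>B j\<bar>)" by (intro add_pos_nonneg sum_nonneg) auto
    fix j t assume *: "j \<in> {2..m+1}" "t \<ge> 0" "A t \<ge> 1"
    have "\<bar>B j\<bar> \<le> (\<Sum>j\<in>{2..m+1}. \<bar>B j\<bar>)" using * by (intro member_le_sum) auto
    then show "cmod (a j t) * A t ^ j \<le> 1 + (\<Sum>j\<in>{2..m+1}. \<bar>B j\<bar>)" using B[OF *] by linarith
  qed
qed

text \<open>\<open>moment 0\<close> is bounded by a multiple of \<open>A ^ 2\<close> because all
  coefficients are bounded by multiples of \<open>A\<close>, yet it grows with the integral of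
  \<open>q\<close>.\<close>

lemma A_at_top: "filterlim A at_top at_top"
  unfolding filterlim_at_top
proof
  fix Z :: real
  \<comment> \<open>There are \<open>m + 2\<close> terms in \<open>moment 0\<close>, each a product
    of two coefficients of size at most \<open>2 ^ m * A t\<close>.\<close>
  define C where "C = real (m + 2) * (2 ^ m * 2 ^ m)"
  have C: "C > 0" by (simp add: C_def)
  have "\<forall>\<^sub>F t in at_top. integral {0..t} q \<ge> (C * Z\<^sup>2 - Re (moment 0 0)) / 2"
    using q_integral unfolding filterlim_at_top by blast
  then show "\<forall>\<^sub>F t in at_top. A t \<ge> Z"
    using eventually_ge_at_top[of 0]
  proof eventually_elim
    case (elim t)
    have A: "A t > 0" using a_1_eq elim by blast
    have "C * Z\<^sup>2 \<le> Re (moment 0 t)"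
      using elim moment_0[of t] by simp
    also have "\<dots> \<le> cmod (moment 0 t)" by (rule complex_Re_le_cmod)
    also have "\<dots> \<le> (\<Sum>j\<le>m+1. (2 ^ m * A t) * (2 ^ m * A t))"
    proof (subst moment_eq_sum)
      show "cmod (\<Sum>j\<le>m+1. coeff (f t ^ 0 * pCons 0 (pderiv (f t))) j * cnj (coeff (f t) j))
          \<le> (\<Sum>j\<le>m+1. (2 ^ m * A t) * (2 ^ m * A t))"
      proof (rule sum_norm_le)
        fix j
        have "cmod (coeff (pCons 0 (pderiv (f t))) j) \<le> 2 ^ m * A t"
          using cmod_coeff_pderiv_f_le[of t] A elim by (cases j) auto
        then show "cmod (coeff (f t ^ 0 * pCons 0 (pderiv (f t))) j * cnj (coeff (f t) j))
            \<le> (2 ^ m * A t) * (2 ^ m * A t)"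
          using cmod_coeff_f_le[of t j] A elim unfolding norm_mult by (intro mult_mono) auto
      qed
    qed (use elim in auto)
    also have "\<dots> = C * (A t)\<^sup>2" by (simp add: C_def power2_eq_square algebra_simps)
    finally have "Z\<^sup>2 \<le> (A t)\<^sup>2" using C by simp
    then show "Z \<le> A t" by (rule power2_le_imp_le) (use A in auto)
  qed
qed

section \<open>Decay of the time derivatives\<close>

definition A' :: "real \<Rightarrow> real" where "A' t = Re (a' 1 t)"

lemma A_has_real_derivative:
  assumes "t \<ge> 0"
  shows "(A has_real_derivative A' t) (at t within {0..})"
  unfolding A_def[abs_def] A'_def has_real_derivative_iff_has_vector_derivative
  by (intro bounded_linear.has_vector_derivative[OF bounded_linear_Re] a_has_vector_derivative assms) auto

lemma a'_1_eq:
  assumes "t \<ge> 0"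
  shows "a' 1 t = of_real (A' t)"
proof -
  have "((\<lambda>s. complex_of_real (A s)) has_vector_derivative of_real (A' t)) (at t within {0..})"
    by (rule has_vector_derivative_of_real) (rule A_has_real_derivative[OF assms])
  then have "(a 1 has_vector_derivative of_real (A' t)) (at t within {0..})"
    by (rule has_vector_derivative_transform[rotated 2]) (use assms a_1_eq(1) in auto)
  then show ?thesis
    using vector_derivative_unique_within[OF at_within_half_line_neq_bot[OF assms]]
      a_has_vector_derivative[OF assms, of 1] by auto
qed

text \<open>The Fourier coefficient of index \<open>n\<close> of the Polubarinova-Galin equation,
  obtained with test polynomial \<open>z ^ n\<close>. In the range of summation \<open>i - n\<close>
  is a true difference.\<close>

lemma coefficient_ode:
  assumes t: "t \<ge> 0"
  shows "(\<Sum>i\<in>{n+1..m+1}. a' (i - n) t * (of_nat i * cnj (a i t)) + of_nat (i - n) * a (i - n) t * cnj (a' i t))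
     = (if n = 0 then 2 * of_real (q t) else 0)"
proof -
  let ?d = "pCons 0 (pderiv (f t))"
  have deg: "degree ?d \<le> m + 1"
    using degree_pCons_0_pderiv_le degree_f_le[OF t] order_trans by blast
  have *: "coeff (monom 1 n * p) j = (if j < n then 0 else coeff p (j - n))" for p :: "complex poly" and j
    by (simp add: coeff_monom_mult)
  have "(if n = 0 then 2 * of_real (q t) else 0) = 2 * of_real (q t) * coeff (monom 1 n :: complex poly) 0"
    by simp
  also have "\<dots> = circle_inner (monom 1 n * ft t) ?d + circle_inner (monom 1 n * ?d) (ft t)"
    using circle_inner_f[OF t, of "monom 1 n"] by simp
  also have "\<dots> = (\<Sum>i\<le>m+1. coeff (monom 1 n * ft t) i * cnj (coeff ?d i) + coeff (monom 1 n * ?d) i * cnj (coeff (ft t) i))"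
    unfolding circle_inner_altdef[OF deg] circle_inner_altdef[OF degree_ft_le] sum.distrib ..
  also have "\<dots> = (\<Sum>i\<in>{n+1..m+1}. coeff (monom 1 n * ft t) i * cnj (coeff ?d i) + coeff (monom 1 n * ?d) i * cnj (coeff (ft t) i))"
    by (intro sum.mono_neutral_right)
       (auto simp: * coeff_pCons_0_pderiv coeff_f[OF t] coeff_ft not_le simp del: coeff_pCons mult_pCons_right)
  also have "\<dots> = (\<Sum>i\<in>{n+1..m+1}. a' (i - n) t * (of_nat i * cnj (a i t)) + of_nat (i - n) * a (i - n) t * cnj (a' i t))"
    by (intro sum.cong)
       (auto simp: * coeff_pCons_0_pderiv coeff_f[OF t] coeff_ft not_le simp del: coeff_pCons mult_pCons_right)
  finally show ?thesis ..
qed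

text \<open>Here \<open>X\<close> is the sum of the weighted derivatives. The equations of index \<open>n \<ge> 1\<close> give
  \<open>X \<le> C \<bar>a\<^sub>1'\<bar> + C X / a\<^sub>1\<^sup>2\<close>, and the last term is absorbed for large \<open>a\<^sub>1\<close>. The equation of
  index \<open>0\<close> then forces \<open>a\<^sub>1' > 0\<close> because \<open>q > 0\<close>.\<close>

lemma derivative_bound:
  obtains K where "K > 0"
    "\<forall>\<^sub>F t in at_top. A' t > 0 \<and> (\<forall>j\<in>{2..m+1}. cmod (a' j t) * A t ^ (j + 1) \<le> K * A' t)"
proof -
  obtain B where B: "B > 0" "\<And>j t. j \<in> {2..m+1} \<Longrightarrow> t \<ge> 0 \<Longrightarrow> A t \<ge> 1 \<Longrightarrow> cmod (a j t) * A t ^ j \<le> B"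
    using coefficient_decay by blast
  define N where "N = real (m + 1)"
  have N: "N \<ge> 1" by (simp add: N_def)
  \<comment> \<open>The factor 2 pays for absorbing \<open>X / 2\<close> into the left-hand side
    below.\<close>
  define K where "K = 2 * (N * (N * B))"
  have K: "K > 0" using B N by (simp add: K_def)
  have "\<forall>\<^sub>F t in at_top. A' t > 0 \<and> (\<forall>j\<in>{2..m+1}. cmod (a' j t) * A t ^ (j + 1) \<le> K * A' t)"
    \<comment> \<open>The first threshold gives \<open>A t >= 1\<close> and the absorption of the
      quadratic terms; the second makes \<open>A t - N * B * K\<close> positive for the sign
      argument.\<close>
    using A_at_top[unfolded filterlim_at_top, rule_format, of "1 + 4 * (N * (N * (N * B)))"]
      A_at_top[unfolded filterlim_at_top, rule_format, of "1 + N * B * K"] eventually_ge_at_top[of 0]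
  proof eventually_elim
    case (elim t)
    note t = \<open>0 \<le> t\<close>
    have "0 \<le> 4 * (N * (N * (N * B)))" using B N by simp
    with elim have A1: "A t \<ge> 1" by linarith
    define x where "x j = cmod (a' j t) * A t ^ (j + 1)" for j
    define X where "X = (\<Sum>j\<in>{2..m+1}. x j)"
    have x_nonneg: "x j \<ge> 0" for j using A1 by (simp add: x_def)
    have x_le: "x j \<le> X" if "j \<in> {2..m+1}" for j
      unfolding X_def using that x_nonneg by (intro member_le_sum) auto
    have X_nonneg: "X \<ge> 0" unfolding X_def by (intro sum_nonneg x_nonneg)
    \<comment> \<open>\<open>a' j\<close> carries weight \<open>j + 1\<close> and \<open>a i\<close>
      weight \<open>i\<close>, so a product tolerates any power of \<open>A t\<close> up to the
      total weight.\<close>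
    have prod_le: "cmod (a' j t) * cmod (a i t) * A t ^ l \<le> B * X"
      if "i \<in> {2..m+1}" "j \<in> {2..m+1}" "l \<le> i + j + 1" for i j l
    proof -
      have "cmod (a' j t) * cmod (a i t) * A t ^ l \<le> cmod (a' j t) * cmod (a i t) * A t ^ (i + j + 1)"
        using A1 that by (intro mult_left_mono power_increasing) auto
      also have "\<dots> = (cmod (a i t) * A t ^ i) * x j" by (simp add: x_def power_add)
      also have "\<dots> \<le> B * X"
        using B(1) B(2)[OF that(1) t A1] x_le[OF that(2)] x_nonneg by (intro mult_mono) auto
      finally show ?thesis .
    qed
    have x_bound: "x (n + 1) \<le> N * B * \<bar>A' t\<bar> + N * (2 * (N * B * X)) / (A t)\<^sup>2" if n: "n \<in> {1..m}" for n
    proof -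
      let ?s = "\<lambda>i. a' (i - n) t * (of_nat i * cnj (a i t)) + of_nat (i - n) * a (i - n) t * cnj (a' i t)"
      have "{n+1..m+1} = insert (n + 1) {n+2..m+1}" using n by auto
      then have "?s (n + 1) + (\<Sum>i\<in>{n+2..m+1}. ?s i) = 0"
        using coefficient_ode[OF t, of n] n by simp
      moreover have s1: "?s (n + 1) = of_real (A' t) * (of_nat (n + 1) * cnj (a (n + 1) t))
          + of_real (A t) * cnj (a' (n + 1) t)"
        using a_1_eq(1)[OF t] a'_1_eq[OF t] by simp
      ultimately have *: "of_real (A t) * cnj (a' (n + 1) t)
          = - (of_real (A' t) * (of_nat (n + 1) * cnj (a (n + 1) t)) + (\<Sum>i\<in>{n+2..m+1}. ?s i))"
        unfolding s1 eq_neg_iff_add_eq_0 by (simp only: add_ac)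
      \<comment> \<open>For \<open>i >= n + 2\<close> the total weight \<open>2 * i - n + 1\<close>
        exceeds \<open>n + 3\<close>, which leaves a spare factor \<open>1 / A ^ 2\<close>.\<close>
      have "cmod (?s i) * A t ^ (n + 1) \<le> 2 * (N * B * X) / (A t)\<^sup>2" if i: "i \<in> {n+2..m+1}" for i
      proof -
        have i': "i \<in> {2..m+1}" "i - n \<in> {2..m+1}" "real i \<le> N" "real (i - n) \<le> N"
          using i n by (auto simp: N_def)
        have 1: "cmod (a' (i - n) t) * cmod (a i t) * A t ^ (n + 3) \<le> B * X"
          and 2: "cmod (a' i t) * cmod (a (i - n) t) * A t ^ (n + 3) \<le> B * X"
          using prod_le[of i "i - n" "n + 3"] prod_le[of "i - n" i "n + 3"] i i' by auto
        have "cmod (?s i) \<le> cmod (a' (i - n) t * (of_nat i * cnj (a i t)))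
            + cmod (of_nat (i - n) * a (i - n) t * cnj (a' i t))"
          by (rule norm_triangle_ineq)
        also have "\<dots> = real i * (cmod (a' (i - n) t) * cmod (a i t))
            + real (i - n) * (cmod (a' i t) * cmod (a (i - n) t))"
          by (simp add: norm_mult mult_ac)
        also have "\<dots> \<le> N * (cmod (a' (i - n) t) * cmod (a i t)) + N * (cmod (a' i t) * cmod (a (i - n) t))"
          using i' by (intro add_mono mult_right_mono) auto
        finally have "cmod (?s i) * A t ^ (n + 3) \<le> \<dots> * A t ^ (n + 3)"
          using A1 by (intro mult_right_mono) auto
        also have "\<dots> = N * (cmod (a' (i - n) t) * cmod (a i t) * A t ^ (n + 3))
            + N * (cmod (a' i t) * cmod (a (i - n) t) * A t ^ (n + 3))"
          by (simp add: algebra_simps)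
        also have "\<dots> \<le> N * (B * X) + N * (B * X)"
          using N 1 2 by (intro add_mono mult_left_mono) auto
        also have "A t ^ (n + 3) = A t ^ (n + 1) * (A t)\<^sup>2"
          by (simp add: power_add power2_eq_square power3_eq_cube)
        finally show ?thesis using A1 by (simp add: field_simps)
      qed
      then have "(\<Sum>i\<in>{n+2..m+1}. cmod (?s i) * A t ^ (n + 1)) \<le> (\<Sum>i\<in>{n+2..m+1}. 2 * (N * B * X) / (A t)\<^sup>2)"
        by (rule sum_mono)
      also have "\<dots> = real (m - n) * (2 * (N * B * X) / (A t)\<^sup>2)" by simp
      also have "\<dots> \<le> N * (2 * (N * B * X) / (A t)\<^sup>2)"
        using N B X_nonneg by (intro mult_right_mono) (auto simp: N_def)
      finally have rest: "(\<Sum>i\<in>{n+2..m+1}. cmod (?s i) * A t ^ (n + 1)) \<le> N * (2 * (N * B * X)) / (A t)\<^sup>2"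
        by simp
      have "x (n + 1) = cmod (of_real (A t) * cnj (a' (n + 1) t)) * A t ^ (n + 1)"
        using A1 by (simp add: x_def norm_mult)
      also have "\<dots> \<le> (cmod (of_real (A' t) * (of_nat (n + 1) * cnj (a (n + 1) t))) + cmod (\<Sum>i\<in>{n+2..m+1}. ?s i)) * A t ^ (n + 1)"
        unfolding * norm_minus_cancel using A1 by (intro mult_right_mono norm_triangle_ineq) auto
      also have "\<dots> \<le> (cmod (of_real (A' t) * (of_nat (n + 1) * cnj (a (n + 1) t))) + (\<Sum>i\<in>{n+2..m+1}. cmod (?s i))) * A t ^ (n + 1)"
        using A1 by (intro mult_right_mono add_left_mono norm_sum) auto
      also have "\<dots> = real (n + 1) * (cmod (a (n + 1) t) * A t ^ (n + 1)) * \<bar>A' t\<bar> + (\<Sum>i\<in>{n+2..m+1}. cmod (?s i) * A t ^ (n + 1))"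
        by (simp add: norm_mult distrib_right sum_distrib_right del: of_nat_Suc of_nat_add power_Suc)
      also have "\<dots> \<le> N * B * \<bar>A' t\<bar> + N * (2 * (N * B * X)) / (A t)\<^sup>2"
        using B n N A1 B(2)[of "n + 1" t] t by (intro add_mono rest mult_right_mono mult_mono) (auto simp: N_def)
      finally show ?thesis .
    qed
    have "X = (\<Sum>n\<in>{1..m}. x (n + 1))"
      unfolding X_def by (rule sum.reindex_bij_witness[of _ "\<lambda>n. n + 1" "\<lambda>j. j - 1"]) auto
    also have "\<dots> \<le> (\<Sum>n\<in>{1..m}. N * B * \<bar>A' t\<bar> + N * (2 * (N * B * X)) / (A t)\<^sup>2)"
      by (intro sum_mono x_bound)
    also have "\<dots> \<le> N * (N * B * \<bar>A' t\<bar> + N * (2 * (N * B * X)) / (A t)\<^sup>2)"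
      using B N X_nonneg by (simp add: N_def mult_right_mono)
    \<comment> \<open>The error is written as a multiple of \<open>X / 2\<close> whose coefficient
      is at most 1.\<close>
    also have "\<dots> = N * (N * B) * \<bar>A' t\<bar> + 4 * (N * (N * (N * B))) / (A t)\<^sup>2 * (X / 2)"
      by (simp add: algebra_simps)
    also have "\<dots> \<le> N * (N * B) * \<bar>A' t\<bar> + 1 * (X / 2)"
    proof (intro add_left_mono mult_right_mono)
      have "4 * (N * (N * (N * B))) \<le> A t * 1" using elim by simp
      also have "\<dots> \<le> A t * A t" using A1 by (intro mult_left_mono) auto
      finally show "4 * (N * (N * (N * B))) / (A t)\<^sup>2 \<le> 1"
        using A1 by (simp add: divide_le_eq power2_eq_square)
    qed (use X_nonneg in auto)
    finally have X_le: "X \<le> K * \<bar>A' t\<bar>" by (simp add: K_def)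
    have "A' t > 0"
    proof (rule ccontr)
      assume neg: "\<not> A' t > 0"
      let ?s = "\<lambda>i. a' i t * (of_nat i * cnj (a i t)) + of_nat i * a i t * cnj (a' i t)"
      have "{1..m+1} = insert 1 {2..m+1}" using m_pos by auto
      then have "?s 1 + (\<Sum>i\<in>{2..m+1}. ?s i) = 2 * of_real (q t)"
        using coefficient_ode[OF t, of 0] by simp
      moreover have s1: "Re (?s 1) = 2 * (A t * A' t)"
        using a_1_eq(1)[OF t] a'_1_eq[OF t] by simp
      ultimately have "Re (?s 1 + (\<Sum>i\<in>{2..m+1}. ?s i)) = 2 * q t" by simp
      then have "2 * q t = 2 * (A t * A' t) + (\<Sum>i\<in>{2..m+1}. Re (?s i))"
        unfolding plus_complex.sel(1)[of "?s 1"] s1 Re_sum by (rule sym)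
      also have "(\<Sum>i\<in>{2..m+1}. Re (?s i)) \<le> (\<Sum>i\<in>{2..m+1}. 2 * (N * B * x i))"
      proof (rule sum_mono)
        fix i assume i: "i \<in> {2..m+1}"
        have "Re (a' i t * cnj (a i t)) \<le> cmod (a' i t) * cmod (a i t) * 1"
          using complex_Re_le_cmod[of "a' i t * cnj (a i t)"] by (simp add: norm_mult)
        also have "\<dots> \<le> cmod (a' i t) * cmod (a i t) * A t ^ (i + i + 1)"
          using A1 by (intro mult_left_mono one_le_power) auto
        also have "\<dots> = (cmod (a i t) * A t ^ i) * x i" by (simp add: x_def power_add)
        also have "\<dots> \<le> B * x i"
          using B(2)[OF i t A1] x_nonneg by (intro mult_right_mono)
        finally have "real i * Re (a' i t * cnj (a i t)) \<le> real i * (B * x i)"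
          by (rule mult_left_mono) simp
        also have "\<dots> \<le> N * (B * x i)"
          using i B x_nonneg by (intro mult_right_mono) (auto simp: N_def)
        finally have "real i * Re (a' i t * cnj (a i t)) \<le> N * (B * x i)" .
        moreover have "Re (?s i) = 2 * (real i * Re (a' i t * cnj (a i t)))" by (simp add: algebra_simps)
        ultimately show "Re (?s i) \<le> 2 * (N * B * x i)" by simp
      qed
      also have "\<dots> = 2 * (N * B * X)" unfolding X_def sum_distrib_left ..
      also have "\<dots> \<le> 2 * (N * B * (K * \<bar>A' t\<bar>))"
        using N B by (intro mult_left_mono X_le) auto
      \<comment> \<open>Under the contrary assumption \<open>\<bar>A' t\<bar> = - A' t\<close>, so
        both terms combine into one product with a nonpositive and a nonnegative factor.\<close>
      finally have "q t \<le> A' t * (A t - N * B * K)"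
        using neg by (simp add: algebra_simps)
      also have "\<dots> \<le> 0" using neg elim by (intro mult_nonpos_nonneg) auto
      finally show False using q_pos[OF t] by simp
    qed
    then show ?case using X_le x_le by (force simp: x_def)
  qed
  with K show ?thesis by (rule that)
qed

section \<open>The rescaled derivative\<close>

text \<open>With this \<open>eps\<close> the rescaling factor of the zeros is \<open>eps / a\<^sub>1\<close>, and since
  \<open>eps\<^sup>m = a\<^sub>1\<^sup>-\<^sup>2\<close> only natural powers of \<open>eps\<close> occur in the rescaled polynomial.\<close>

definition eps :: "real \<Rightarrow> real" where "eps t = A t powr (- 2 / real m)"

text \<open>The leading coefficient of the limit polynomial \<open>1 + L * z ^ m\<close>.\<close>

definition L :: complex where "L = of_nat (m + 1) * cnj (moment m 0)"

text \<open>The coefficient of \<open>z ^ (j - 1)\<close> in \<open>f' / A\<close> at the point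
  \<open>z * A / eps\<close>: the negative powers of \<open>eps\<close> disappear by multiplying
  with \<open>A ^ 2 * eps ^ m = 1\<close>. For \<open>2 <= j <= m\<close> at least one factor
  \<open>eps\<close> remains.\<close>

definition b :: "nat \<Rightarrow> real \<Rightarrow> complex" where
  "b j t = of_nat j * (a j t * of_real (A t ^ j * eps t ^ (m + 1 - j)))"

definition rescaled :: "real \<Rightarrow> complex \<Rightarrow> complex" where
  "rescaled t z = 1 + L * z ^ m + (\<Sum>j\<in>{2..m}. b j t * z ^ (j - 1))"

definition w :: "nat \<Rightarrow> real \<Rightarrow> complex" where
  "w k t = \<omega> k t * of_real (A t powr (- (real m + 2) / real m))"

lemma L_neq_0: "L \<noteq> 0"
  using moment_top_neq_0 by (simp add: L_def del: of_nat_Suc of_nat_add)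

lemma eps_pos: "t \<ge> 0 \<Longrightarrow> eps t > 0"
  using a_1_eq(2)[of t] by (simp add: eps_def)

lemma eps_power:
  assumes "t \<ge> 0"
  shows "eps t ^ m = 1 / (A t)\<^sup>2"
proof -
  have "eps t ^ m = A t powr (- 2 / real m * real m)"
    unfolding eps_def using m_pos a_1_eq(2)[OF assms] by (subst powr_power) (auto simp: mult.commute)
  also have "- 2 / real m * real m = - 2" using m_pos by simp
  finally show ?thesis using a_1_eq(2)[OF assms] by (simp add: powr_minus divide_inverse)
qed

lemma w_eq: assumes "t \<ge> 0" shows "w k t = \<omega> k t * of_real (eps t / A t)"
proof -
  have "- (real m + 2) / real m = - 2 / real m + (- 1)" using m_pos by (simp add: field_simps)
  then have "A t powr (- (real m + 2) / real m) = eps t / A t"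
    using a_1_eq(2)[OF assms] by (simp only: powr_add eps_def) (simp add: powr_minus divide_inverse)
  then show ?thesis by (simp add: w_def)
qed

lemma eps_tendsto_0: "(eps \<longlongrightarrow> 0) at_top"
  unfolding eps_def[abs_def] using m_pos by (intro tendsto_neg_powr A_at_top) auto

text \<open>Evaluates \<open>f'\<close> at \<open>z * A / eps\<close> in two ways, from its
  coefficients and from its zeros, and cancels \<open>A\<close>.\<close>

lemma rescaled_eq_prod:
  assumes t: "t \<ge> 0"
  shows "rescaled t z = L * (\<Prod>k\<in>{1..m}. z - w k t)"
proof -
  let ?A = "complex_of_real (A t)" and ?e = "complex_of_real (eps t)" and ?p = "pderiv (f t)"
  have nz: "?A \<noteq> 0" "?e \<noteq> 0" using a_1_eq(2)[OF t] eps_pos[OF t] by auto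
  have em: "?e ^ m = 1 / ?A\<^sup>2" using arg_cong[OF eps_power[OF t], of complex_of_real] by simp
  \<comment> \<open>Conservation of the top moment expresses the constant \<open>L\<close> by
    coefficients at the current time.\<close>
  have L_eq: "L = of_nat (m + 1) * (a (m + 1) t * ?A ^ (m + 1))"
    unfolding L_def moment_constant[OF t m_pos, symmetric] moment_top[OF t] a_1_eq(1)[OF t]
    by (simp only: complex_cnj_mult complex_cnj_power complex_cnj_complex_of_real complex_cnj_cnj mult_ac)
  have "a (m + 1) t \<noteq> 0" using L_neq_0 L_eq by auto
  then have "degree (f t) = m + 1"
    using le_degree[of "f t" "m + 1"] degree_f_le[OF t] coeff_f[OF t, of "m + 1"] by (intro antisym) auto
  then have deg: "degree ?p = m" by (simp add: degree_pderiv)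
  then have lc: "lead_coeff ?p = of_nat (m + 1) * a (m + 1) t"
    by (simp add: coeff_pderiv coeff_f[OF t])
  have "poly ?p (z * ?A / ?e) = (\<Sum>i\<le>m. coeff ?p i * (z * ?A / ?e) ^ i)"
    by (simp add: poly_altdef deg)
  also have "\<dots> = (\<Sum>j\<in>{1..m+1}. of_nat j * a j t * (z * ?A / ?e) ^ (j - 1))"
    by (rule sum.reindex_bij_witness[of _ "\<lambda>j. j - 1" "\<lambda>i. i + 1"])
       (auto simp: coeff_pderiv coeff_f[OF t] not_less_eq_eq)
  also have "\<dots> = (\<Sum>j\<in>{1..m+1}. ?A * (b j t * z ^ (j - 1)))"
  proof (rule sum.cong[OF refl])
    fix j assume j: "j \<in> {1..m+1}"
    then obtain i where i: "j = i + 1" "i \<le> m" by (cases j) auto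
    have "?e ^ (m - i) * ?e ^ i = 1 / ?A\<^sup>2" using i em by (simp flip: power_add)
    then have emi: "?e ^ (m - i) = 1 / (?A\<^sup>2 * ?e ^ i)" using nz by (simp add: field_simps)
    have mi: "m + 1 - j = m - i" using i by simp
    then show "of_nat j * a j t * (z * ?A / ?e) ^ (j - 1) = ?A * (b j t * z ^ (j - 1))"
      unfolding b_def mi of_real_mult of_real_power emi
      using nz by (simp add: i(1) field_simps power2_eq_square)
  qed
  also have "\<dots> = ?A * rescaled t z"
  proof -
    have "{1..m+1} = insert 1 (insert (m + 1) {2..m})" using m_pos by auto
    moreover have "b 1 t = 1" using nz em a_1_eq(1)[OF t] by (simp add: b_def power2_eq_square)
    moreover have "b (m + 1) t = L" by (simp add: b_def L_eq)
    ultimately show ?thesis using m_pos by (simp add: rescaled_def sum_distrib_left algebra_simps)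
  qed
  finally have 1: "poly ?p (z * ?A / ?e) = ?A * rescaled t z" .
  have "poly ?p (z * ?A / ?e) = lead_coeff ?p * (\<Prod>k\<in>{1..m}. z * ?A / ?e - \<omega> k t)"
    by (subst pderiv_f_eq_prod[OF t]) (simp add: poly_prod)
  also have "(\<Prod>k\<in>{1..m}. z * ?A / ?e - \<omega> k t) = (\<Prod>k\<in>{1..m}. (?A / ?e) * (z - w k t))"
    using nz by (intro prod.cong) (auto simp: w_eq[OF t] field_simps)
  also have "\<dots> = (?A / ?e) ^ m * (\<Prod>k\<in>{1..m}. z - w k t)"
    unfolding prod.distrib by simp
  also have "lead_coeff ?p * \<dots> = ?A * (L * (\<Prod>k\<in>{1..m}. z - w k t))"
    using nz unfolding lc L_eq power_divide em by (simp add: power2_eq_square field_simps)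
  finally show ?thesis using 1 nz by simp
qed

text \<open>The time derivative of \<open>b j\<close>; the real factor beside \<open>a j\<close> is
  the logarithmic derivative of \<open>A ^ j * eps ^ (m + 1 - j)\<close>, where \<open>eps\<close>
  contributes the rate \<open>- (2 / m) * A' / A\<close>.\<close>

definition b' :: "nat \<Rightarrow> real \<Rightarrow> complex" where
  "b' j t = of_nat j * of_real (A t ^ j * eps t ^ (m + 1 - j)) *
     (a' j t + a j t * of_real ((real j - real (m + 1 - j) * (2 / real m)) * (A' t / A t)))"

definition rescaled' :: "real \<Rightarrow> complex \<Rightarrow> complex" where
  "rescaled' t z = (\<Sum>j\<in>{2..m}. b' j t * z ^ (j - 1))"

lemma at_within_half_line: "t > 0 \<Longrightarrow> at t within {0::real..} = at t"
  by (rule at_within_interior) auto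

lemma A_deriv: "t > 0 \<Longrightarrow> (A has_real_derivative A' t) (at t)"
  using A_has_real_derivative[of t] by (simp add: at_within_half_line)

lemma eps_deriv:
  assumes t: "t > 0"
  shows "(eps has_real_derivative - (2 / real m) * eps t * (A' t / A t)) (at t)"
proof -
  have "A t > 0" using a_1_eq(2) t by simp
  then have "((\<lambda>s. A s powr (- 2 / real m)) has_real_derivative
      (- 2 / real m) * A t powr (- 2 / real m - 1) * A' t) (at t)"
    using DERIV_chain2[OF has_real_derivative_powr A_deriv[OF t]] by blast
  also have "(- 2 / real m) * A t powr (- 2 / real m - 1) * A' t = - (2 / real m) * eps t * (A' t / A t)"
    using \<open>A t > 0\<close> by (simp add: eps_def powr_diff)
  finally show ?thesis unfolding eps_def[abs_def] .
qed

lemma b_deriv: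
  assumes t: "t > 0" and j: "j \<in> {2..m}"
  shows "(b j has_vector_derivative b' j t) (at t)"
proof -
  let ?n = "m + 1 - j"
  have A: "A t > 0" "eps t > 0" using a_1_eq(2) eps_pos t by auto
  have n: "A t ^ j = A t ^ (j - 1) * A t" "eps t ^ ?n = eps t ^ (?n - 1) * eps t"
    using j by (simp_all add: Suc_diff_le flip: power_Suc2)
  have "((\<lambda>s. A s ^ j * eps s ^ ?n) has_real_derivative
      of_nat j * (A' t * A t ^ (j - Suc 0)) * eps t ^ ?n
        + of_nat ?n * (- (2 / real m) * eps t * (A' t / A t) * eps t ^ (?n - Suc 0)) * A t ^ j) (at t)"
    by (intro DERIV_mult DERIV_power A_deriv eps_deriv t)
  also have "of_nat j * (A' t * A t ^ (j - Suc 0)) * eps t ^ ?n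
        + of_nat ?n * (- (2 / real m) * eps t * (A' t / A t) * eps t ^ (?n - Suc 0)) * A t ^ j
      = A t ^ j * eps t ^ ?n * ((real j - real ?n * (2 / real m)) * (A' t / A t))"
  proof -
    have "real j * (A' t * P) * (E * eps t)
          + real ?n * (- (2 / real m) * eps t * (A' t / A t) * E) * (P * A t)
        = P * A t * (E * eps t) * ((real j - real ?n * (2 / real m)) * (A' t / A t))" for P E
      using A by (simp add: algebra_simps)
    then show ?thesis by (simp only: n flip: One_nat_def)
  qed
  finally have "((\<lambda>s. complex_of_real (A s ^ j * eps s ^ ?n)) has_vector_derivative
      of_real (A t ^ j * eps t ^ ?n * ((real j - real ?n * (2 / real m)) * (A' t / A t)))) (at t)"
    by (rule has_vector_derivative_of_real)
  moreover have "(a j has_vector_derivative a' j t) (at t)"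
    using a_has_vector_derivative[of t j] t j by (simp add: at_within_half_line)
  ultimately have "(b j has_vector_derivative of_nat j * (a j t *
        of_real (A t ^ j * eps t ^ ?n * ((real j - real ?n * (2 / real m)) * (A' t / A t)))
        + a' j t * of_real (A t ^ j * eps t ^ ?n))) (at t)"
    unfolding b_def[abs_def] by (intro has_vector_derivative_mult_right has_vector_derivative_mult)
  then show ?thesis by (simp add: b'_def algebra_simps)
qed

lemma rescaled_deriv:
  assumes "t > 0"
  shows "((\<lambda>s. rescaled s z) has_vector_derivative rescaled' t z) (at t)"
proof -
  have "((\<lambda>s. (1 + L * z ^ m) + (\<Sum>j\<in>{2..m}. b j s * z ^ (j - 1))) has_vector_derivative
     0 + (\<Sum>j\<in>{2..m}. b' j t * z ^ (j - 1))) (at t)"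
    by (intro has_vector_derivative_add has_vector_derivative_const has_vector_derivative_sum
          has_vector_derivative_mult_left b_deriv assms)
  then show ?thesis by (simp add: rescaled_def rescaled'_def)
qed

text \<open>The weights \<open>A ^ j\<close> are absorbed by the decay of \<open>a j\<close> and
  \<open>a' j\<close>. What remains is at least one factor \<open>eps\<close>, and for the time
  derivative also \<open>A' / A\<close>.\<close>

lemma rescaled_bounds:
  assumes "R \<ge> 1"
  obtains C where "C > 0"
    "\<forall>\<^sub>F t in at_top. A' t > 0 \<and> (\<forall>z. cmod z \<le> R \<longrightarrow>
        cmod (rescaled t z - (1 + L * z ^ m)) \<le> C * eps t \<and>
        cmod (rescaled' t z) \<le> C * (eps t * (A' t / A t)))"
proof -
  obtain B where B: "B > 0" "\<And>j t. j \<in> {2..m+1} \<Longrightarrow> t \<ge> 0 \<Longrightarrow> A t \<ge> 1 \<Longrightarrow> cmod (a j t) * A t ^ j \<le> B"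
    using coefficient_decay by blast
  obtain K where K: "K > 0"
    "\<forall>\<^sub>F t in at_top. A' t > 0 \<and> (\<forall>j\<in>{2..m+1}. cmod (a' j t) * A t ^ (j + 1) \<le> K * A' t)"
    using derivative_bound by blast
  \<comment> \<open>\<open>C1\<close> bounds the \<open>b' j\<close>; the number
    \<open>3 * m\<close> bounds the logarithmic rate
    \<open>j - (m + 1 - j) * (2 / m)\<close>.\<close>
  define C1 where "C1 = real m * (K + B * (3 * real m))"
  \<comment> \<open>One constant for both estimates; \<open>m * R ^ m\<close> is a crude bound for
    the sum of the powers of \<open>z\<close>.\<close>
  define C where "C = (real m * B + C1) * (real m * R ^ m)"
  have pos: "C1 > 0" using K B m_pos by (auto simp: C1_def intro!: mult_pos_pos add_pos_pos)
  have "C > 0" unfolding C_def using pos B m_pos assms by (intro mult_pos_pos add_nonneg_pos) auto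
  moreover have "\<forall>\<^sub>F t in at_top. A' t > 0 \<and> (\<forall>z. cmod z \<le> R \<longrightarrow>
        cmod (rescaled t z - (1 + L * z ^ m)) \<le> C * eps t \<and>
        cmod (rescaled' t z) \<le> C * (eps t * (A' t / A t)))"
    using K(2) A_at_top[unfolded filterlim_at_top, rule_format, of 1] eventually_ge_at_top[of 0]
  proof eventually_elim
    case (elim t)
    note t = \<open>0 \<le> t\<close> and A1 = \<open>1 \<le> A t\<close>
    have e: "0 < eps t" "eps t \<le> 1" using eps_pos[OF t] powr_mono[of "- 2 / real m" 0 "A t"] A1
      by (auto simp: eps_def)
    let ?y = "A' t / A t"
    have y: "?y > 0" using elim by simp
    have sum_le: "cmod (\<Sum>j\<in>{2..m}. c j * z ^ (j - 1)) \<le> S * (real m * R ^ m)"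
      if "\<And>j. j \<in> {2..m} \<Longrightarrow> cmod (c j) \<le> S" "S \<ge> 0" "cmod z \<le> R" for c z S
    proof -
      have "cmod (\<Sum>j\<in>{2..m}. c j * z ^ (j - 1)) \<le> (\<Sum>j\<in>{2..m}. S * R ^ m)"
      proof (rule sum_norm_le)
        fix j assume j: "j \<in> {2..m}"
        have "cmod z ^ (j - 1) \<le> R ^ (j - 1)" using that by (intro power_mono) auto
        also have "\<dots> \<le> R ^ m" using assms j by (intro power_increasing) auto
        finally show "cmod (c j * z ^ (j - 1)) \<le> S * R ^ m"
          unfolding norm_mult norm_power using that j by (intro mult_mono) auto
      qed
      also have "\<dots> = real (m - 1) * (S * R ^ m)" by simp
      also have "\<dots> \<le> real m * (S * R ^ m)"
        using that assms by (intro mult_right_mono) auto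
      finally show ?thesis by (simp add: mult_ac)
    qed
    have ep: "eps t ^ (m + 1 - j) \<le> eps t" if "j \<in> {2..m}" for j
      using power_decreasing[of 1 "m + 1 - j" "eps t"] e that by auto
    have b: "cmod (b j t) \<le> real m * B * eps t" if j: "j \<in> {2..m}" for j
    proof -
      have "cmod (b j t) = real j * ((cmod (a j t) * A t ^ j) * eps t ^ (m + 1 - j))"
        using A1 e by (simp add: b_def norm_mult norm_power mult_ac)
      also have "\<dots> \<le> real m * (B * eps t)"
        using B(1) B(2)[of j t] j t A1 ep[OF j] e by (intro mult_mono) auto
      finally show ?thesis by simp
    qed
    have b': "cmod (b' j t) \<le> C1 * (eps t * ?y)" if j: "j \<in> {2..m}" for j
    proof -
      have a': "cmod (a' j t) * A t ^ j \<le> K * ?y"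
      proof -
        have "cmod (a' j t) * A t ^ (j + 1) \<le> K * A' t" using elim j by auto
        then show ?thesis using A1 by (simp add: field_simps)
      qed
      have c: "\<bar>real j - real (m + 1 - j) * (2 / real m)\<bar> \<le> 3 * real m"
      proof -
        have "real (m + 1 - j) * (2 / real m) \<le> real m * (2 / real m)"
          using j by (intro mult_right_mono) auto
        then have "real (m + 1 - j) * (2 / real m) \<le> 2" using m_pos by simp
        moreover have "0 \<le> real (m + 1 - j) * (2 / real m)" by simp
        moreover have "2 \<le> real j" "real j \<le> real m" using j by auto
        ultimately show ?thesis by linarith
      qed
      have "cmod (b' j t) = real j * eps t ^ (m + 1 - j) * (A t ^ j *
          cmod (a' j t + a j t * of_real ((real j - real (m + 1 - j) * (2 / real m)) * ?y)))"
        using A1 e by (simp add: b'_def norm_mult norm_power mult_ac)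
      also have "\<dots> \<le> real m * eps t * (K * ?y + B * (3 * real m * ?y))"
      proof (intro mult_mono)
        have "A t ^ j * cmod (a' j t + a j t * of_real ((real j - real (m + 1 - j) * (2 / real m)) * ?y))
            \<le> A t ^ j * (cmod (a' j t) + cmod (a j t * of_real ((real j - real (m + 1 - j) * (2 / real m)) * ?y)))"
          using A1 by (intro mult_left_mono norm_triangle_ineq) auto
        also have "\<dots> = cmod (a' j t) * A t ^ j + (cmod (a j t) * A t ^ j) * (\<bar>real j - real (m + 1 - j) * (2 / real m)\<bar> * ?y)"
          unfolding norm_mult norm_of_real abs_mult abs_of_pos[OF y] by (simp add: algebra_simps)
        also have "\<dots> \<le> K * ?y + B * (3 * real m * ?y)"
          using B(1) B(2)[of j t] j t A1 y c by (intro add_mono a' mult_mono mult_nonneg_nonneg) auto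
        finally show "A t ^ j * cmod (a' j t + a j t * of_real ((real j - real (m + 1 - j) * (2 / real m)) * ?y))
            \<le> K * ?y + B * (3 * real m * ?y)" .
      qed (use j e A1 ep[OF j] in auto)
      also have "\<dots> = C1 * (eps t * ?y)" by (simp add: C1_def algebra_simps)
      finally show ?thesis .
    qed
    have Cge: "real m * B * (real m * R ^ m) \<le> C" "C1 * (real m * R ^ m) \<le> C"
      using pos B assms by (auto simp: C_def distrib_right)
    have "cmod (rescaled t z - (1 + L * z ^ m)) \<le> C * eps t \<and>
        cmod (rescaled' t z) \<le> C * (eps t * ?y)" if z: "cmod z \<le> R" for z
    proof
      have "rescaled t z - (1 + L * z ^ m) = (\<Sum>j\<in>{2..m}. b j t * z ^ (j - 1))"
        by (simp add: rescaled_def)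
      also have "cmod \<dots> \<le> (real m * B * eps t) * (real m * R ^ m)"
        using b z B e by (intro sum_le) auto
      also have "\<dots> = (real m * B * (real m * R ^ m)) * eps t" by simp
      also have "\<dots> \<le> C * eps t"
        using e by (intro mult_right_mono Cge) auto
      finally show "cmod (rescaled t z - (1 + L * z ^ m)) \<le> C * eps t" .
      have "cmod (rescaled' t z) \<le> (C1 * (eps t * ?y)) * (real m * R ^ m)"
        unfolding rescaled'_def using pos e y by (intro sum_le b' z mult_nonneg_nonneg) auto
      also have "\<dots> = (C1 * (real m * R ^ m)) * (eps t * ?y)" by simp
      also have "\<dots> \<le> C * (eps t * ?y)"
        using e y by (intro mult_right_mono Cge mult_nonneg_nonneg) auto
      finally show "cmod (rescaled' t z) \<le> C * (eps t * ?y)" .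
    qed
    then show ?case using elim by blast
  qed
  ultimately show ?thesis by (rule that)
qed

section \<open>Limits and outward motion of the zeros\<close>

text \<open>At a root \<open>v i\<close> of the limit polynomial, \<open>rescaled\<close> is only
  the error term and tends to 0. Divided by \<open>L\<close> it is the product of the differences
  \<open>v i - w k t\<close>, as the matching of roots requires.\<close>

lemma rescaled_zeros_tendsto:
  assumes v: "inj_on v {1..m}" "\<And>i. i \<in> {1..m} \<Longrightarrow> 1 + L * v i ^ m = 0"
  obtains \<sigma> where "\<And>t. \<sigma> t permutes {1..m}"
    "\<And>i. i \<in> {1..m} \<Longrightarrow> ((\<lambda>t. w (\<sigma> t i) t) \<longlongrightarrow> v i) at_top"
proof (rule root_matching[OF m_pos v(1)])
  fix i assume i: "i \<in> {1..m}"
  obtain C where C: "C > 0"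
    "\<forall>\<^sub>F t in at_top. A' t > 0 \<and> (\<forall>z. cmod z \<le> 1 + cmod (v i) \<longrightarrow>
        cmod (rescaled t z - (1 + L * z ^ m)) \<le> C * eps t \<and>
        cmod (rescaled' t z) \<le> C * (eps t * (A' t / A t)))"
    by (rule rescaled_bounds[of "1 + cmod (v i)"]) auto
  have "((\<lambda>t. C * eps t) \<longlongrightarrow> C * 0) at_top"
    by (intro tendsto_intros eps_tendsto_0)
  then have "((\<lambda>t. C * eps t) \<longlongrightarrow> 0) at_top" by simp
  moreover have "\<forall>\<^sub>F t in at_top. cmod (rescaled t (v i)) \<le> C * eps t"
    using C(2)
  proof eventually_elim
    case (elim t)
    then have "cmod (rescaled t (v i) - (1 + L * v i ^ m)) \<le> C * eps t" by simp
    then show ?case by (simp add: v(2)[OF i])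
  qed
  ultimately have "((\<lambda>t. rescaled t (v i)) \<longlongrightarrow> 0) at_top"
    by (rule Lim_null_comparison[rotated])
  then have "((\<lambda>t. rescaled t (v i) / L) \<longlongrightarrow> 0 / L) at_top"
    by (intro tendsto_intros L_neq_0)
  then have lim: "((\<lambda>t. rescaled t (v i) / L) \<longlongrightarrow> 0) at_top" by simp
  show "((\<lambda>t. \<Prod>k\<in>{1..m}. v i - w k t) \<longlongrightarrow> 0) at_top"
    by (rule Lim_transform_eventually[OF lim], rule eventually_mono[OF eventually_ge_at_top[of 0]])
       (simp add: rescaled_eq_prod L_neq_0)
qed (use that in blast)

text \<open>The modulus of a zero is \<open>A / eps\<close> times that of its rescaled zero
  \<open>x i\<close>. The first factor has logarithmic rate \<open>(1 + 2 / m) * A' / A\<close>,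
  whereas \<open>x i\<close> has modulus at least \<open>d\<close> and speed less than
  \<open>d * A' / A\<close> once \<open>eps\<close> is small.\<close>

lemma zeros_move_outwards:
  assumes \<sigma>: "\<And>t. \<sigma> t permutes {1..m}"
    and lim: "\<And>i. i \<in> {1..m} \<Longrightarrow> ((\<lambda>t. w (\<sigma> t i) t) \<longlongrightarrow> v i) at_top"
    and v: "inj_on v {1..m}" "\<And>i. i \<in> {1..m} \<Longrightarrow> v i \<noteq> 0"
  shows "\<forall>\<^sub>F t in at_top. \<forall>i\<in>{1..m}. \<exists>D>0.
      ((\<lambda>s. cmod (\<omega> (\<sigma> s i) s)) has_real_derivative D) (at t)"
proof -
  obtain d where d: "d > 0" "\<And>i. i \<in> {1..m} \<Longrightarrow> 2 * d \<le> cmod (v i)"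
    "\<And>i k. i \<in> {1..m} \<Longrightarrow> k \<in> {1..m} \<Longrightarrow> i \<noteq> k \<Longrightarrow> 3 * d \<le> cmod (v i - v k)"
    using min_distance_pos[OF v] by blast
  define x where "x i t = w (\<sigma> t i) t" for i t
  \<comment> \<open>A radius that contains every point within \<open>d\<close> of some
    \<open>v i\<close>.\<close>
  define R where "R = 1 + d + (\<Sum>i\<in>{1..m}. cmod (v i))"
  have R: "R \<ge> 1" using d(1) by (simp add: R_def sum_nonneg)
  obtain C where C: "C > 0"
    "\<forall>\<^sub>F t in at_top. A' t > 0 \<and> (\<forall>z. cmod z \<le> R \<longrightarrow>
        cmod (rescaled t z - (1 + L * z ^ m)) \<le> C * eps t \<and>
        cmod (rescaled' t z) \<le> C * (eps t * (A' t / A t)))"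
    using rescaled_bounds[OF R] by blast
  \<comment> \<open>\<open>c\<close> bounds the denominator of the velocity \<open>V\<close> from
    below, so \<open>eps < d * c / C\<close> will give \<open>cmod V < d * A' / A\<close>.\<close>
  define c where "c = cmod L * d ^ (m - 1)"
  have c: "c > 0" using d(1) L_neq_0 by (simp add: c_def)
  have "\<forall>\<^sub>F t in at_top. \<forall>i\<in>{1..m}. dist (x i t) (v i) < d"
    unfolding x_def by (intro eventually_ball_finite ballI tendstoD[OF lim] d(1)) auto
  \<comment> \<open>An explicit threshold is needed because the derivative at \<open>t\<close> also
    involves the zeros at nearby times \<open>s\<close>.\<close>
  then obtain T where T: "\<And>t i. t \<ge> T \<Longrightarrow> i \<in> {1..m} \<Longrightarrow> dist (x i t) (v i) < d"
    unfolding eventually_at_top_linorder by blast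
  have "\<forall>\<^sub>F t in at_top. eps t < d * c / C"
    by (rule order_tendstoD[OF eps_tendsto_0]) (use d(1) c C(1) in auto)
  then show ?thesis
    using C(2) eventually_gt_at_top[of "max T 0"]
  proof eventually_elim
    case (elim t)
    have t: "t > T" "t > 0" using elim by auto
    have pos: "A t > 0" "eps t > 0" "A' t > 0" using a_1_eq(2)[of t] eps_pos[of t] elim by auto
    have near: "\<forall>\<^sub>F s in nhds t. s > max T 0"
      using eventually_nhds_in_open[of "{max T 0<..}" t] t by simp
    have sep: "cmod (x i t - x k s) \<ge> d" if "i \<in> {1..m}" "k \<in> {1..m}" "i \<noteq> k" "s > max T 0" for i k s
    proof -
      have "cmod (v i - v k) \<le> cmod (v i - x i t) + cmod (x i t - x k s) + cmod (x k s - v k)"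
        using norm_triangle_ineq[of "v i - x i t" "x i t - x k s"]
          norm_triangle_ineq[of "v i - x k s" "x k s - v k"] by simp
      moreover have "cmod (v i - x i t) < d" "cmod (x k s - v k) < d"
        using T[of t i] T[of s k] that t by (auto simp: dist_norm norm_minus_commute)
      ultimately show ?thesis using d(3)[OF that(1-3)] by linarith
    qed
    \<comment> \<open>Relabelling by \<open>\<sigma> s\<close> does not change the product over all
      zeros.\<close>
    have P: "rescaled s z = L * (\<Prod>k\<in>{1..m}. z - x k s)" if "s > max T 0" for s z
      using rescaled_eq_prod[of s z] prod.permute[OF \<sigma>[of s], of "\<lambda>k. z - w k s"] that
      by (simp add: x_def o_def)
    show ?case
    proof
      fix i assume i: "i \<in> {1..m}"
      define V where "V = - rescaled' t (x i t) / (L * (\<Prod>k\<in>{1..m}-{i}. x i t - x k t))"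
      have xd: "(x i has_vector_derivative V) (at t)"
        unfolding V_def
      proof (rule separated_root_has_vector_derivative[OF i L_neq_0 d(1), where P = rescaled])
        show "\<forall>\<^sub>F s in nhds t. \<forall>z. rescaled s z = L * (\<Prod>k\<in>{1..m}. z - x k s)"
          using near by eventually_elim (use P in blast)
        show "\<forall>\<^sub>F s in nhds t. \<forall>i\<in>{1..m}. \<forall>k\<in>{1..m}. i \<noteq> k \<longrightarrow> d \<le> cmod (x i t - x k s)"
          using near by eventually_elim (use sep in blast)
      qed (rule rescaled_deriv[OF t(2)])
      have x_near: "cmod (x i t - v i) < d" using T[of t i] i t by (simp add: dist_norm)
      have x_ge: "cmod (x i t) \<ge> d"
        using d(2)[OF i] x_near norm_triangle_ineq2[of "v i" "x i t"] by (simp add: norm_minus_commute)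
      have "cmod (v i) \<le> (\<Sum>i\<in>{1..m}. cmod (v i))" using i by (intro member_le_sum) auto
      then have x_le: "cmod (x i t) \<le> R"
        using x_near norm_triangle_ineq2[of "x i t" "v i"] by (simp add: R_def)
      have "d ^ (m - 1) = (\<Prod>k\<in>{1..m}-{i}. d)" using i by simp
      also have "\<dots> \<le> (\<Prod>k\<in>{1..m}-{i}. cmod (x i t - x k t))"
        by (intro prod_mono) (use sep[of i _ t] i d(1) t in auto)
      finally have "c \<le> cmod (L * (\<Prod>k\<in>{1..m}-{i}. x i t - x k t))"
        by (simp add: c_def norm_mult prod_norm mult_left_mono)
      then have "cmod V \<le> C * (eps t * (A' t / A t)) / c"
        unfolding V_def norm_divide norm_minus_cancel
        using elim x_le c C(1) pos by (intro frac_le) auto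
      also have "\<dots> = (A' t / A t) * (C * eps t / c)" by simp
      also have "\<dots> < (A' t / A t) * d"
        using elim C(1) c pos by (intro mult_strict_left_mono) (auto simp: field_simps)
      finally have V: "cmod V < (A' t / A t) * d" .
      have x0: "x i t \<noteq> 0" using x_ge d(1) by auto
      have nd: "((\<lambda>s. cmod (x i s)) has_real_derivative V \<bullet> sgn (x i t)) (at t)"
        using has_derivative_compose[OF xd[unfolded has_vector_derivative_def] has_derivative_norm[OF x0]]
        by (simp add: has_field_derivative_def mult.commute[of _ "V \<bullet> sgn (x i t)"] mult_commute_abs)
      have gd: "((\<lambda>s. A s / eps s) has_real_derivative (A t / eps t) * ((1 + 2 / real m) * (A' t / A t))) (at t)"
      proof -
        have "((\<lambda>s. A s / eps s) has_real_derivative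
            (A' t * eps t - A t * (- (2 / real m) * eps t * (A' t / A t))) / (eps t * eps t)) (at t)"
          by (intro DERIV_divide A_deriv eps_deriv t) (use pos in auto)
        also have "(A' t * eps t - A t * (- (2 / real m) * eps t * (A' t / A t))) / (eps t * eps t)
            = (A t / eps t) * ((1 + 2 / real m) * (A' t / A t))"
          using pos m_pos by (simp add: field_simps)
        finally show ?thesis .
      qed
      let ?D = "(A t / eps t) * ((1 + 2 / real m) * (A' t / A t)) * cmod (x i t)
          + (V \<bullet> sgn (x i t)) * (A t / eps t)"
      have "((\<lambda>s. A s / eps s * cmod (x i s)) has_real_derivative ?D) (at t)"
        by (rule DERIV_mult[OF gd nd])
      moreover have "\<forall>\<^sub>F s in nhds t. cmod (\<omega> (\<sigma> s i) s) = A s / eps s * cmod (x i s)"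
        using near
      proof eventually_elim
        case (elim s)
        then have "A s > 0" "eps s > 0" "s \<ge> 0" using a_1_eq(2)[of s] eps_pos[of s] by auto
        then show ?case by (simp add: x_def w_eq norm_mult norm_divide)
      qed
      ultimately have "((\<lambda>s. cmod (\<omega> (\<sigma> s i) s)) has_real_derivative ?D) (at t)"
        by (subst DERIV_cong_ev[OF refl _ refl])
      moreover have "?D > 0"
      proof -
        have "- (V \<bullet> sgn (x i t)) \<le> cmod V * cmod (sgn (x i t))"
          using Cauchy_Schwarz_ineq2[of V "sgn (x i t)"] by linarith
        also have "\<dots> < (A' t / A t) * d" using V x0 by (simp add: norm_sgn)
        also have "\<dots> \<le> (A' t / A t) * cmod (x i t)"
          using x_ge pos by (intro mult_left_mono) auto
        also have "\<dots> \<le> ((1 + 2 / real m) * (A' t / A t)) * cmod (x i t)"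
          using pos mult_right_mono[of 1 "1 + 2 / real m" "A' t / A t"]
          by (intro mult_right_mono) auto
        finally have "0 < (A t / eps t) * (((1 + 2 / real m) * (A' t / A t)) * cmod (x i t) + V \<bullet> sgn (x i t))"
          using pos by (intro mult_pos_pos) auto
        then show ?thesis by (simp only: distrib_left mult.assoc mult.commute[of "V \<bullet> sgn (x i t)"])
      qed
      ultimately show "\<exists>D>0. ((\<lambda>s. cmod (\<omega> (\<sigma> s i) s)) has_real_derivative D) (at t)" by blast
    qed
  qed
qed

end

theorem theorem5p1:
  fixes m :: nat
    and a :: "nat \<Rightarrow> real \<Rightarrow> complex"
    and f :: "real \<Rightarrow> complex poly"
    and q :: "real \<Rightarrow> real"
    and \<omega> :: "nat \<Rightarrow> real \<Rightarrow> complex"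
    and \<omega>h :: "nat \<Rightarrow> complex"
    and M :: complex
  assumes "m \<ge> 1"
    and f: "\<And>t. t \<ge> 0 \<Longrightarrow> f t = (\<Sum>j=1..m+1. monom (a j t) j)"
    and sol: "global_locally_univalent_solution q (\<lambda>\<zeta> t. poly (f t) \<zeta>)"
    and "a (m + 1) 0 \<noteq> 0"
    and "continuous_on {0..} q"
    and "\<And>t. t \<ge> 0 \<Longrightarrow> q t > 0"
    and "filterlim (\<lambda>t. integral {0..t} q) at_top at_top"
    and zeros: "\<And>t. t \<ge> 0 \<Longrightarrow>
        proots (pderiv (f t)) = image_mset (\<lambda>k. \<omega> k t) (mset_set {1..m})"
    and M: "M = harmonic_moment (poly (f 0)) m"
    and roots: "bij_betw \<omega>h {1..m} {z. z ^ m = - 1 / ((of_nat m + 1) * cnj M)}"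
  shows "(\<forall>t\<ge>0. harmonic_moment (poly (f t)) m = M \<and>
                M = a 1 t ^ (m + 1) * cnj (a (m + 1) t)) \<and> M \<noteq> 0 \<and>
    (\<exists>\<sigma> :: real \<Rightarrow> nat \<Rightarrow> nat.
       (\<forall>t\<ge>0. \<sigma> t permutes {1..m}) \<and>
       (\<forall>k\<in>{1..m}. ((\<lambda>t. cmod (\<omega> (\<sigma> t k) t
            * of_real (Re (a 1 t) powr (- (real m + 2) / real m)) - \<omega>h k)) \<longlongrightarrow> 0) at_top) \<and>
       (\<forall>\<^sub>F t in at_top. \<forall>k\<in>{1..m}. \<exists>D>0.
            ((\<lambda>s. cmod (\<omega> (\<sigma> s k) s)) has_real_derivative D) (at t)))"
proof -
  interpret polynomial_solution m a f q \<omega>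
    by unfold_locales (fact assms)+
  have hm: "harmonic_moment (poly (f t)) m = moment m t" for t
    by (simp add: harmonic_moment_poly moment_def)
  have M_eq: "M = moment m 0" by (simp add: M hm)
  \<comment> \<open>By this identity the prescribed numbers \<open>\<omega>h i\<close> are roots of
    the limit polynomial \<open>1 + L * z ^ m\<close>.\<close>
  have L: "L = (of_nat m + 1) * cnj M" by (simp add: L_def M_eq)
  have root: "\<omega>h i ^ m = - 1 / L" if "i \<in> {1..m}" for i
    using bij_betwE[OF roots] that unfolding L by blast
  have inj: "inj_on \<omega>h {1..m}" using roots by (rule bij_betw_imp_inj_on)
  \<comment> \<open>The zeros are given only as a multiset at each time, so their labels may jump;
    hence the permutation depends on \<open>t\<close>. The same \<open>\<sigma>\<close> serves the
    convergence and the outward motion.\<close>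
  obtain \<sigma> where \<sigma>: "\<And>t. \<sigma> t permutes {1..m}"
    "\<And>i. i \<in> {1..m} \<Longrightarrow> ((\<lambda>t. w (\<sigma> t i) t) \<longlongrightarrow> \<omega>h i) at_top"
    using rescaled_zeros_tendsto[OF inj] root L_neq_0 by auto
  have "\<omega>h i \<noteq> 0" if "i \<in> {1..m}" for i
    using root[OF that] L_neq_0 m_pos by (auto simp: power_0_left)
  from zeros_move_outwards[OF \<sigma> inj this]
  have "\<forall>\<^sub>F t in at_top. \<forall>k\<in>{1..m}. \<exists>D>0.
            ((\<lambda>s. cmod (\<omega> (\<sigma> s k) s)) has_real_derivative D) (at t)" .
  moreover have "((\<lambda>t. cmod (\<omega> (\<sigma> t k) t
            * of_real (Re (a 1 t) powr (- (real m + 2) / real m)) - \<omega>h k)) \<longlongrightarrow> 0) at_top"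
    if "k \<in> {1..m}" for k
    using \<sigma>(2)[OF that] unfolding w_def A_def by (intro tendsto_norm_zero LIM_zero)
  moreover have "harmonic_moment (poly (f t)) m = M \<and> M = a 1 t ^ (m + 1) * cnj (a (m + 1) t)"
    if "t \<ge> 0" for t
    using moment_constant[OF that m_pos] moment_top[OF that] by (simp add: hm M_eq)
  moreover have "M \<noteq> 0" using moment_top_neq_0 M_eq by simp
  ultimately show ?thesis using \<sigma>(1) by blast
qed

end
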